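(* Let $f(x)=a_1x^n+a_2x^{n-1}+\dots+a_nx+a_{n+1}$ be an irreducible polynomial of degree $n$ in $\mathbb{Z}[x]$, let $\mathcal{B}(x,y)=a_1x^n+a_2x^{n-1}y+\dots+a_{n+1}y^n$ (so $f(x)=\mathcal{B}(x,1)$), let $\zeta$ be a root of $f$ and $E=\mathbb{Q}(\zeta)$ with discriminant $\Delta$. Suppose $a_0$ is a nonzero rational integer with $a_0^2\mid a_1$ and $a_0\mid a_2$ such that the discriminant of $\mathcal{B}$ equals $\Delta a_0^2$. Then $\{\omega_0,\omega_1,\dots,\omega_{n-1}\}$, where $\omega_0=1$, $\omega_1=\frac{a_1}{a_0}\zeta$, and $\omega_j=\sum_{k=1}^{j}a_k\zeta^{j+1-k}$ for $j>1$, is an integral basis for the ring of integers $\mathcal{O}_E$ of $E$.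
   Context: The discriminant of the binary form $\mathcal{B}$ is $a_1^{2(n-1)}\prod_{i<j}(\delta_i-\delta_j)^2$, where $\delta_1,\dots,\delta_n$ are the roots of $\mathcal{B}(x,1)$. The pair $[a_0,\mathcal{B}]$ with the stated properties is called an essential pair. *)

theory Defs
  imports
    Complex_Main
    "HOL-Computational_Algebra.Computational_Algebra"
    "Jordan_Normal_Form.Determinant"
begin

section \<open>Number fields inside the complex numbers\<close>

definition is_subfield :: "complex set \<Rightarrow> bool" where
  "is_subfield K \<longleftrightarrow>
     0 \<in> K \<and> 1 \<in> K \<and>
     (\<forall>x\<in>K. \<forall>y\<in>K. x + y \<in> K \<and> x * y \<in> K) \<and>
     (\<forall>x\<in>K. - x \<in> K \<and> inverse x \<in> K)"

text \<open>The field $\mathbb{Q}(\zeta)$. Every subfield of the complex numbers contains the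
  rationals, so they need not be adjoined explicitly.\<close>

definition rat_adjoin :: "complex \<Rightarrow> complex set" where
  "rat_adjoin z = is_subfield hull {z}"

definition ring_of_integers :: "complex set \<Rightarrow> complex set" where
  "ring_of_integers E = {x \<in> E. algebraic_int x}"

definition is_integral_basis :: "complex set \<Rightarrow> complex list \<Rightarrow> bool" where
  "is_integral_basis E bs \<longleftrightarrow>
     set bs \<subseteq> ring_of_integers E \<and>
     (\<forall>x\<in>ring_of_integers E. \<exists>!cs :: int list. length cs = length bs \<and>
        x = (\<Sum>i<length bs. of_int (cs ! i) * bs ! i))"

text \<open>Embeddings are taken to be extensional, i.e. equal to \<^const>\<open>undefined\<close> outside \<open>E\<close>,
  so that each embedding of \<open>E\<close> is counted exactly once.\<close>

definition field_embeddings :: "complex set \<Rightarrow> (complex \<Rightarrow> complex) set" where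
  "field_embeddings E =
     {\<sigma> \<in> extensional E. \<sigma> 1 = 1 \<and>
        (\<forall>x\<in>E. \<forall>y\<in>E. \<sigma> (x + y) = \<sigma> x + \<sigma> y \<and> \<sigma> (x * y) = \<sigma> x * \<sigma> y)}"

definition field_trace :: "complex set \<Rightarrow> complex \<Rightarrow> complex" where
  "field_trace E x = (\<Sum>\<sigma>\<in>field_embeddings E. \<sigma> x)"

definition basis_disc :: "complex set \<Rightarrow> complex list \<Rightarrow> complex" where
  "basis_disc E bs =
     det (mat (length bs) (length bs) (\<lambda>(i, j). field_trace E (bs ! i * bs ! j)))"

text \<open>The common value of the discriminants of all integral bases.\<close>

definition field_disc :: "complex set \<Rightarrow> int" where
  "field_disc E = (THE d. \<exists>bs. is_integral_basis E bs \<and> of_int d = basis_disc E bs)"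

section \<open>Binary forms\<close>

text \<open>A form of degree \<open>n\<close> is given by its coefficients \<open>a 1, \<dots>, a (n + 1)\<close>,
  in order of decreasing powers of \<open>x\<close>; other values of \<open>a\<close> are irrelevant.\<close>

definition binary_form :: "nat \<Rightarrow> (nat \<Rightarrow> int) \<Rightarrow> complex \<Rightarrow> complex \<Rightarrow> complex" where
  "binary_form n a x y = (\<Sum>k=1..n+1. of_int (a k) * x ^ (n + 1 - k) * y ^ (k - 1))"

text \<open>The list \<open>ds\<close> below enumerates the roots of the form at \<open>y = 1\<close> with multiplicity.
  The definition is meaningful for \<open>n \<ge> 1\<close> and \<open>a 1 \<noteq> 0\<close>.\<close>

definition binary_form_disc :: "nat \<Rightarrow> (nat \<Rightarrow> int) \<Rightarrow> complex" where
  "binary_form_disc n a =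
     (THE d. \<exists>ds. length ds = n \<and>
        (\<forall>x. binary_form n a x 1 = of_int (a 1) * (\<Prod>i<n. x - ds ! i)) \<and>
        d = of_int (a 1) ^ (2 * (n - 1)) * (\<Prod>j<n. \<Prod>i<j. (ds ! i - ds ! j)\<^sup>2))"

definition omega :: "int \<Rightarrow> (nat \<Rightarrow> int) \<Rightarrow> complex \<Rightarrow> nat \<Rightarrow> complex" where
  "omega a0 a z j =
     (if j = 0 then 1
      else if j = 1 then of_int (a 1) / of_int a0 * z
      else (\<Sum>k=1..j. of_int (a k) * z ^ (j + 1 - k)))"

end

theory Submission
  imports
    Defs
    "Jordan_Normal_Form.Char_Poly"
    "Berlekamp_Zassenhaus.Factor_Bound"
begin

hide_const (open) up_ring.monom up_ring.coeff module.smult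

text \<open>
  Write \<open>\<delta>\<close> for the roots of \<open>f\<close>. The discriminant of a list of \<open>n\<close> elements of \<open>E\<close> is multiplied by
  \<open>(det C)\<^sup>2\<close> under a rational change of basis \<open>C\<close>, and for \<open>1, \<zeta>, \<dots>, \<zeta>\<^bsup>n-1\<^esup>\<close> it is the square of
  the Vandermonde determinant of the \<open>\<delta>\<close>. The \<open>\<omega>\<close> arise from the powers of \<open>\<zeta>\<close> by a triangular
  matrix of determinant \<open>a\<^sub>1\<^bsup>n-1\<^esup> / a\<^sub>0\<close>, so their discriminant is that of the form divided by \<open>a\<^sub>0\<^sup>2\<close>,
  which is \<open>\<Delta>\<close>. They are integral because multiplication by \<open>\<omega>\<^sub>j\<close> (\<open>j \<ge> 2\<close>) preserves
  \<open>\<int> + \<int>\<zeta> + \<dots> + \<int>\<zeta>\<^bsup>n-1\<^esup>\<close> and multiplication by \<open>\<omega>\<^sub>1\<close> preserves the \<open>\<int>\<close>-span of the \<open>\<omega>\<close>. Finally,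
  a list of \<open>n\<close> integers of \<open>E\<close> whose discriminant is nonzero and of least absolute value is an
  integral basis: if \<open>x\<close> had a non-integral coordinate \<open>q\<close>, replacing that basis element \<open>b\<close> by
  \<open>x - \<lfloor>q\<rfloor> b\<close> would multiply the discriminant by \<open>(frac q)\<^sup>2 < 1\<close>. Hence \<open>\<Delta>\<close> is this least value up to
  sign, and the \<open>\<omega>\<close> attain it.
\<close>

section \<open>Algebraic integers\<close>

text \<open>For finite \<open>S\<close> this is the \<int>-module generated by \<open>S\<close>. For
  infinite \<open>S\<close> the sum is 0 by convention and the span collapses to 0.\<close>

definition int_span :: "'a :: comm_ring_1 set \<Rightarrow> 'a set" where
  "int_span S = {x. \<exists>c :: 'a \<Rightarrow> int. x = (\<Sum>s\<in>S. of_int (c s) * s)}"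

lemma int_span_0: "0 \<in> int_span S"
  unfolding int_span_def by (auto intro!: exI[of _ "\<lambda>_. 0"])

lemma int_span_add:
  assumes "x \<in> int_span S" "y \<in> int_span S"
  shows "x + y \<in> int_span S"
proof -
  from assms obtain c d :: "'a \<Rightarrow> int"
    where "x = (\<Sum>s\<in>S. of_int (c s) * s)" "y = (\<Sum>s\<in>S. of_int (d s) * s)"
    unfolding int_span_def by blast
  then have "x + y = (\<Sum>s\<in>S. of_int (c s + d s) * s)"
    by (simp add: sum.distrib distrib_right)
  then show ?thesis
    unfolding int_span_def by (intro CollectI exI[of _ "\<lambda>s. c s + d s"])
qed

lemma int_span_of_int_mult:
  assumes "x \<in> int_span S"
  shows "of_int k * x \<in> int_span S"
proof -
  from assms obtain c :: "'a \<Rightarrow> int" where "x = (\<Sum>s\<in>S. of_int (c s) * s)"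
    unfolding int_span_def by blast
  then have "of_int k * x = (\<Sum>s\<in>S. of_int (k * c s) * s)"
    by (simp add: sum_distrib_left mult.assoc)
  then show ?thesis
    unfolding int_span_def by (intro CollectI exI[of _ "\<lambda>s. k * c s"])
qed

lemma int_span_sum:
  assumes "\<And>i. i \<in> A \<Longrightarrow> g i \<in> int_span S"
  shows "sum g A \<in> int_span S"
  using assms by (induction A rule: infinite_finite_induct) (auto intro: int_span_0 int_span_add)

lemma int_span_uminus:
  assumes "x \<in> int_span S"
  shows "- x \<in> int_span S"
  using int_span_of_int_mult[OF assms, of "-1"] by simp

lemma int_span_base:
  assumes "finite S" "x \<in> S"
  shows "x \<in> int_span S"
proof -
  have "x = (\<Sum>s\<in>S. of_int (if s = x then 1 else 0) * s)"
    using assms by (simp add: if_distrib[of "\<lambda>t. of_int t * _"] sum.delta cong: if_cong)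
  then show ?thesis
    unfolding int_span_def by (intro CollectI exI[of _ "\<lambda>s. if s = x then 1 else 0"])
qed

text \<open>Passes from the generators to the whole span, so that stabilizing factors can be
  composed; this gives stability under a product \<open>x * y\<close>.\<close>

lemma int_span_mult_closed:
  assumes "\<And>s. s \<in> S \<Longrightarrow> u * s \<in> int_span S" "x \<in> int_span S"
  shows "u * x \<in> int_span S"
proof -
  from assms(2) obtain c :: "'a \<Rightarrow> int" where "x = (\<Sum>s\<in>S. of_int (c s) * s)"
    unfolding int_span_def by blast
  then have "u * x = (\<Sum>s\<in>S. of_int (c s) * (u * s))"
    by (simp add: sum_distrib_left mult_ac)
  also have "\<dots> \<in> int_span S"
    by (intro int_span_sum int_span_of_int_mult assms(1))
  finally show ?thesis .
qed

text \<open>The characteristic polynomial of multiplication by \<open>u\<close> witnesses integrality.\<close>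

lemma algebraic_int_if_stabilizes_int_span:
  fixes u :: "'a :: field_char_0"
  assumes "finite S" "s0 \<in> S" "s0 \<noteq> 0" and stab: "\<And>s. s \<in> S \<Longrightarrow> u * s \<in> int_span S"
  shows "algebraic_int u"
proof -
  obtain xs where xs: "distinct xs" "set xs = S"
    using finite_distinct_list[OF assms(1)] by auto
  define m where "m = length xs"
  have "\<forall>s\<in>S. \<exists>c :: 'a \<Rightarrow> int. u * s = (\<Sum>t\<in>S. of_int (c t) * t)"
    using stab unfolding int_span_def by blast
  then obtain c :: "'a \<Rightarrow> 'a \<Rightarrow> int"
    where c: "\<And>s. s \<in> S \<Longrightarrow> u * s = (\<Sum>t\<in>S. of_int (c s t) * t)"
    by metis
  define A where "A = mat m m (\<lambda>(i, j). c (xs ! i) (xs ! j))"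
  have A: "A \<in> carrier_mat m m"
    unfolding A_def by simp
  let ?A = "map_mat of_int A :: 'a mat"
  have A': "?A \<in> carrier_mat m m"
    using A by simp
  let ?v = "vec m (\<lambda>i. xs ! i)"
  have sum_xs: "(\<Sum>t\<in>S. g t) = (\<Sum>j<m. g (xs ! j))" for g :: "'a \<Rightarrow> 'a"
    using sum.reindex_bij_betw[OF bij_betw_nth[OF xs(1) _ xs(2)[symmetric]], of "{..<m}" g]
    by (simp add: m_def)
  \<comment> \<open>The relations \<open>c\<close> say that the vector of generators is an
    eigenvector of the integer matrix \<open>A\<close> with eigenvalue \<open>u\<close>.\<close>
  have "?A *\<^sub>v ?v = u \<cdot>\<^sub>v ?v"
  proof (rule eq_vecI)
    fix i assume "i < dim_vec (u \<cdot>\<^sub>v ?v)"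
    then have i: "i < m" by simp
    then have "xs ! i \<in> S"
      using xs(2) by (auto simp: m_def)
    then show "(?A *\<^sub>v ?v) $ i = (u \<cdot>\<^sub>v ?v) $ i"
      using i A c[of "xs ! i"]
      by (simp add: scalar_prod_def sum_xs atLeast0LessThan A_def)
  qed (use A in simp)
  moreover have "?v \<noteq> 0\<^sub>v m"
  proof
    assume eq: "?v = 0\<^sub>v m"
    obtain i where "i < m" "xs ! i = s0"
      using assms(2) xs(2) by (auto simp: m_def in_set_conv_nth)
    with arg_cong[OF eq, of "\<lambda>w. vec_index w i"] assms(3) show False by simp
  qed
  ultimately have "eigenvalue ?A u"
    unfolding eigenvalue_def eigenvector_def using A by (intro exI[of _ ?v]) auto
  then have "poly (char_poly ?A) u = 0"
    using eigenvalue_root_char_poly[OF A'] by simp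
  then have "poly (map_poly of_int (char_poly A)) u = 0"
    by (simp add: of_int_hom.char_poly_hom[OF A])
  moreover have "lead_coeff (char_poly A) = 1"
    using degree_monic_char_poly[OF A] by simp
  ultimately show ?thesis
    unfolding algebraic_int_altdef_ipoly by blast
qed

text \<open>A monic relation solved for its top power. The degree is positive because the constant
  polynomial 1 has no root.\<close>

lemma algebraic_int_imp_power_eq:
  fixes x :: "'a :: field_char_0"
  assumes "algebraic_int x"
  obtains d and c :: "nat \<Rightarrow> int" where "d > 0" "x ^ d = (\<Sum>i<d. of_int (c i) * x ^ i)"
proof -
  from assms obtain p :: "int poly" where p: "poly (map_poly of_int p) x = 0" "lead_coeff p = 1"
    unfolding algebraic_int_altdef_ipoly by blast
  have "degree p > 0"
  proof (rule ccontr)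
    assume "\<not> degree p > 0"
    then obtain c where "p = [:c:]"
      by (auto elim: degree_eq_zeroE)
    with p show False by simp
  qed
  moreover have "(\<Sum>i\<le>degree p. of_int (coeff p i) * x ^ i) = 0"
    using p(1) by (simp add: poly_altdef degree_map_poly coeff_map_poly)
  then have "x ^ degree p = (\<Sum>i<degree p. of_int (- coeff p i) * x ^ i)"
    using p(2) by (simp add: lessThan_Suc_atMost[symmetric] sum_negf add_eq_0_iff)
  ultimately show ?thesis
    using that[of "degree p" "\<lambda>i. - coeff p i"] by blast
qed

text \<open>The \<int>-span of the products \<open>x ^ i * y ^ j\<close> with \<open>i < d\<close>
  and \<open>j < e\<close> is stable under \<open>x\<close> and under \<open>y\<close>, hence under
  their sum and product.\<close>

lemma algebraic_int_add_mult:
  fixes x y :: "'a :: field_char_0"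
  assumes "algebraic_int x" "algebraic_int y"
  shows "algebraic_int (x + y)" "algebraic_int (x * y)"
proof -
  obtain d c where d: "d > 0" "x ^ d = (\<Sum>i<d. of_int (c i :: int) * x ^ i)"
    using algebraic_int_imp_power_eq[OF assms(1)] .
  obtain e b where e: "e > 0" "y ^ e = (\<Sum>i<e. of_int (b i :: int) * y ^ i)"
    using algebraic_int_imp_power_eq[OF assms(2)] .
  define S where "S = (\<lambda>(i, j). x ^ i * y ^ j) ` ({..<d} \<times> {..<e})"
  have fin: "finite S"
    unfolding S_def by simp
  have one: "1 \<in> S"
    unfolding S_def using d(1) e(1) by (auto intro!: image_eqI[of _ _ "(0, 0)"])
  have mem: "x ^ i * y ^ j \<in> int_span S" if "i < d" "j < e" for i j
    by (rule int_span_base[OF fin]) (use that in \<open>auto simp: S_def\<close>)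
  have X: "x * s \<in> int_span S" if "s \<in> S" for s
  proof -
    from that obtain i j where ij: "i < d" "j < e" "s = x ^ i * y ^ j"
      unfolding S_def by auto
    show ?thesis
    proof (cases "Suc i < d")
      case True
      from mem[OF this ij(2)] show ?thesis by (simp add: ij(3) mult.assoc)
    next
      case False
      \<comment> \<open>The exponent leaves the range, and the monic relation for \<open>x\<close>
        brings \<open>x ^ d\<close> back to lower powers.\<close>
      with ij have "Suc i = d" by simp
      then have "x * s = x ^ d * y ^ j"
        by (auto simp: ij(3) mult.assoc)
      also have "\<dots> = (\<Sum>k<d. of_int (c k) * (x ^ k * y ^ j))"
        by (simp add: d(2) sum_distrib_right mult.assoc)
      also have "\<dots> \<in> int_span S"
        using ij by (intro int_span_sum int_span_of_int_mult mem) auto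
      finally show ?thesis .
    qed
  qed
  have Y: "y * s \<in> int_span S" if "s \<in> S" for s
  proof -
    from that obtain i j where ij: "i < d" "j < e" "s = x ^ i * y ^ j"
      unfolding S_def by auto
    show ?thesis
    proof (cases "Suc j < e")
      case True
      from mem[OF ij(1) this] show ?thesis by (simp add: ij(3) mult_ac)
    next
      case False
      with ij have "Suc j = e" by simp
      then have "y * s = x ^ i * y ^ e"
        by (auto simp: ij(3) mult_ac)
      also have "\<dots> = (\<Sum>k<e. of_int (b k) * (x ^ i * y ^ k))"
        by (simp add: e(2) sum_distrib_left mult_ac)
      also have "\<dots> \<in> int_span S"
        using ij by (intro int_span_sum int_span_of_int_mult mem) auto
      finally show ?thesis .
    qed
  qed
  show "algebraic_int (x + y)"
    by (rule algebraic_int_if_stabilizes_int_span[OF fin one])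
       (auto simp: distrib_right intro: int_span_add X Y)
  show "algebraic_int (x * y)"
    by (rule algebraic_int_if_stabilizes_int_span[OF fin one])
       (auto simp: mult.assoc intro: int_span_mult_closed[OF X] Y)
qed

lemma algebraic_int_of_int: "algebraic_int (of_int k :: 'a :: field_char_0)"
  by (rule int_imp_algebraic_int) simp

lemma algebraic_int_sum:
  fixes g :: "'b \<Rightarrow> 'a :: field_char_0"
  assumes "\<And>i. i \<in> A \<Longrightarrow> algebraic_int (g i)"
  shows "algebraic_int (sum g A)"
  using assms by (induction A rule: infinite_finite_induct) (auto intro: algebraic_int_add_mult)

section \<open>Determinants\<close>

text \<open>The monic polynomials \<open>\<Prod>k<j. (X - d k)\<close> make the matrix triangular.\<close>

lemma det_vandermonde:
  fixes d :: "nat \<Rightarrow> 'a :: idom"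
  shows "det (mat n n (\<lambda>(i, j). d i ^ j)) = (\<Prod>j<n. \<Prod>k<j. d j - d k)"
proof -
  define p where "p j = (\<Prod>k<j. [:- d k, 1:])" for j
  have deg: "degree (p j) = j" for j
    unfolding p_def by (subst degree_prod_eq_sum_degree) auto
  have monic: "coeff (p j) j = 1" for j
    using lead_coeff_prod[of "\<lambda>k. [:- d k, 1:]" "{..<j}"] deg[of j] by (simp add: p_def)
  let ?V = "mat n n (\<lambda>(i, j). d i ^ j)"
  let ?U = "mat n n (\<lambda>(i, j). coeff (p j) i)"
  let ?N = "mat n n (\<lambda>(i, j). \<Prod>k<j. d i - d k)"
  have "(\<Sum>k<n. d i ^ k * coeff (p j) k) = (\<Prod>k<j. d i - d k)" if "j < n" for i j
  proof -
    have "(\<Sum>k<n. d i ^ k * coeff (p j) k) = (\<Sum>k\<le>j. d i ^ k * coeff (p j) k)"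
      by (rule sum.mono_neutral_right) (use that in \<open>auto intro: coeff_eq_0 simp: deg\<close>)
    also have "\<dots> = poly (p j) (d i)"
      by (simp add: poly_altdef deg mult.commute)
    finally show ?thesis
      by (simp add: p_def poly_prod)
  qed
  then have "?V * ?U = ?N"
    by (intro eq_matI) (auto simp: scalar_prod_def atLeast0LessThan)
  then have "det ?N = det ?V * det ?U"
    using det_mult[of ?V n ?U] by simp
  moreover have "det ?U = 1"
    by (subst det_upper_triangular[of _ n])
       (auto simp: upper_triangular_def deg monic prod_list_diag_prod intro!: coeff_eq_0)
  \<comment> \<open>For \<open>i < j\<close> the product contains the factor
    \<open>d i - d i\<close>, so \<open>?N\<close> is lower triangular.\<close>
  moreover have "det ?N = (\<Prod>j<n. \<Prod>k<j. d j - d k)"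
    by (subst det_lower_triangular[of n])
       (auto simp: prod_list_diag_prod atLeast0LessThan)
  ultimately show ?thesis by simp
qed

text \<open>Cramer's rule for the identity matrix: the transpose is \<open>1\<^sub>m n\<close> with
  column \<open>k\<close> replaced by \<open>q\<close>. It serves for the exchange of a single basis
  element.\<close>

lemma det_replace_row_one:
  fixes q :: "nat \<Rightarrow> 'a :: idom"
  assumes "k < n"
  shows "det (mat n n (\<lambda>(i, j). if i = k then q j else if i = j then 1 else 0)) = q k"
    (is "det ?A = _")
proof -
  have "?A = (replace_col (1\<^sub>m n) (1\<^sub>m n *\<^sub>v vec n q) k)\<^sup>T"
    by (intro eq_matI) (auto simp: replace_col_def)
  then have "det ?A = det (replace_col (1\<^sub>m n) (1\<^sub>m n *\<^sub>v vec n q) k)"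
    by (subst det_transpose[symmetric, of _ n]) (auto simp: replace_col_def)
  also have "\<dots> = q k"
    using assms by (subst cramer_lemma_mat[of _ n]) auto
  finally show ?thesis .
qed

section \<open>The field generated by a root of an irreducible integer polynomial\<close>

lemma is_subfield_of_rat:
  assumes "is_subfield K"
  shows "of_rat r \<in> K"
proof -
  have nat: "of_nat m \<in> K" for m
    using assms by (induction m) (auto simp: is_subfield_def)
  have int: "of_int k \<in> K" for k
  proof (cases "k \<ge> 0")
    case True
    then show ?thesis using nat[of "nat k"] by simp
  next
    case False
    then have "of_int (- k) \<in> K"
      using nat[of "nat (- k)"] by simp
    then have "- of_int (- k) \<in> K"
      using assms unfolding is_subfield_def by blast
    then show ?thesis by simp
  qed
  obtain a b where "r = of_int a / of_int b"
    by (metis quotient_of_div surj_pair)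
  then have "of_rat r = of_int a * inverse (of_int b :: complex)"
    by (simp add: divide_inverse of_rat_mult of_rat_inverse)
  then show ?thesis
    using int assms by (auto simp: is_subfield_def)
qed

lemma is_subfield_poly:
  assumes "is_subfield K" "x \<in> K"
  shows "poly (map_poly of_rat p) x \<in> K"
proof (induction p)
  case 0
  then show ?case using assms by (simp add: is_subfield_def)
next
  case (pCons c p)
  then show ?case
    using assms is_subfield_of_rat[OF assms(1), of c] by (simp add: is_subfield_def map_poly_pCons)
qed

lemma complex_of_rat_eq_of_real: "(of_rat r :: complex) = of_real (of_rat r)"
  by (cases r) (simp add: of_rat_rat)

locale int_poly_root =
  fixes f :: "int poly" and \<zeta> :: complex
  assumes irr: "irreducible f" and root: "poly (map_poly of_int f) \<zeta> = 0"
begin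

abbreviation "E \<equiv> rat_adjoin \<zeta>"

definition "n = degree f"

definition "F = (map_poly of_int f :: rat poly)"

definition "R = {x :: complex. poly (map_poly of_int f) x = 0}"

abbreviation ev :: "rat poly \<Rightarrow> complex \<Rightarrow> complex" where
  "ev p \<equiv> poly (map_poly of_rat p)"

lemma ev_simps [simp]:
  "ev (p + q) x = ev p x + ev q x" "ev (p * q) x = ev p x * ev q x"
  "ev (p - q) x = ev p x - ev q x" "ev (- p) x = - ev p x"
  "ev (smult c p) x = of_rat c * ev p x" "ev (p ^ k) x = ev p x ^ k"
  "ev 0 x = 0" "ev 1 x = 1" "ev [:c:] x = of_rat c" "ev [:0, 1:] x = x"
proof -
  interpret H: map_poly_inj_idom_hom "of_rat :: rat \<Rightarrow> complex" ..
  show "ev (p + q) x = ev p x + ev q x" "ev (p * q) x = ev p x * ev q x"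
    "ev (p - q) x = ev p x - ev q x" "ev (- p) x = - ev p x"
    "ev (smult c p) x = of_rat c * ev p x" "ev (p ^ k) x = ev p x ^ k"
    "ev 0 x = 0" "ev 1 x = 1" "ev [:c:] x = of_rat c" "ev [:0, 1:] x = x"
    by (simp_all add: hom_distribs)
qed

lemma ev_sum: "ev (sum g A) x = (\<Sum>i\<in>A. ev (g i) x)"
  by (induction A rule: infinite_finite_induct) auto

lemma f_nonzero: "f \<noteq> 0"
  using irr by auto

text \<open>\<int>[x] has irreducible constants, the primes up to sign; having a root rules them
  out.\<close>

lemma n_pos: "n > 0"
proof (rule ccontr)
  assume "\<not> n > 0"
  then obtain c where "f = [:c:]"
    by (auto simp: n_def elim: degree_eq_zeroE)
  with root f_nonzero show False by simp
qed

lemma degree_F: "degree F = n"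
  by (simp add: F_def n_def)

lemma F_nonzero: "F \<noteq> 0"
  using degree_F n_pos by auto

lemma ev_F: "ev F x = poly (map_poly of_int f) x"
  by (simp add: F_def map_poly_map_poly o_def)

text \<open>Gauss's lemma, applicable because an irreducible integer polynomial of positive degree
  is primitive.\<close>

lemma irreducible_F: "irreducible F"
proof -
  have "irreducible\<^sub>d f"
    using irr n_pos unfolding n_def
    by (metis irreducible_primitive_connect irreducible_imp_primitive less_numeral_extra(3))
  then show ?thesis
    unfolding F_def using irreducible\<^sub>d_int_rat by auto
qed

lemma bezout_F:
  assumes "\<not> F dvd p"
  obtains u v where "u * F + v * p = 1"
proof -
  have "Rings.coprime F p"
    using irreducible_F assms by (intro prime_elem_imp_coprime irreducible_imp_prime_elem) auto
  then have "fst (bezout_coefficients F p) * F + snd (bezout_coefficients F p) * p = 1"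
    using bezout_coefficients_fst_snd[of F p] by (simp add: coprime_iff_gcd_eq_1)
  then show ?thesis using that by blast
qed

text \<open>Up to a constant \<open>F\<close> is the minimal polynomial of each of its roots: if
  \<open>F\<close> does not divide \<open>p\<close>, evaluating \<open>u * F + v * p = 1\<close> at
  a common root gives 0 = 1.\<close>

lemma root_iff_dvd:
  assumes "x \<in> R"
  shows "ev p x = 0 \<longleftrightarrow> F dvd p"
proof
  assume "F dvd p"
  then obtain q where "p = F * q" by blast
  then show "ev p x = 0" using assms by (simp add: ev_F R_def)
next
  assume p: "ev p x = 0"
  show "F dvd p"
  proof (rule ccontr)
    assume "\<not> F dvd p"
    then obtain u v where "u * F + v * p = 1" by (rule bezout_F)
    then have "ev (u * F + v * p) x = 1" by simp
    then show False using assms p by (simp add: ev_F R_def)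
  qed
qed

lemma zeta_in_R: "\<zeta> \<in> R"
  using root by (simp add: R_def)

text \<open>Conjugation principle: a rational relation at \<zeta> is a divisibility by
  \<open>F\<close>, which is visible at every root. Embeddings, traces and conjugate integers rest
  on it.\<close>

lemma ev_eq_transfer:
  assumes "ev p \<zeta> = ev q \<zeta>" "x \<in> R"
  shows "ev p x = ev q x"
proof -
  have "ev (p - q) \<zeta> = 0" using assms(1) by simp
  then have "F dvd p - q" using root_iff_dvd zeta_in_R by blast
  then have "ev (p - q) x = 0" using root_iff_dvd assms(2) by blast
  then show ?thesis by simp
qed

text \<open>The values of rational polynomials at \<zeta> are already closed under inverses, by the
  Bezout identity; conversely every subfield containing \<zeta> contains them.\<close>

lemma E_eq: "E = range (\<lambda>p. ev p \<zeta>)"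
proof (rule antisym)
  have "is_subfield (range (\<lambda>p. ev p \<zeta>))"
    unfolding is_subfield_def
  proof (intro conjI ballI)
    show "0 \<in> range (\<lambda>p. ev p \<zeta>)"
      by (rule range_eqI[of _ _ 0]) simp
    show "1 \<in> range (\<lambda>p. ev p \<zeta>)"
      by (rule range_eqI[of _ _ 1]) simp
  next
    fix x y assume "x \<in> range (\<lambda>p. ev p \<zeta>)" "y \<in> range (\<lambda>p. ev p \<zeta>)"
    then obtain p q where "x = ev p \<zeta>" "y = ev q \<zeta>" by auto
    then show "x + y \<in> range (\<lambda>p. ev p \<zeta>)" "x * y \<in> range (\<lambda>p. ev p \<zeta>)"
      by (auto intro: range_eqI[of _ _ "p + q"] range_eqI[of _ _ "p * q"])
  next
    fix x assume "x \<in> range (\<lambda>p. ev p \<zeta>)"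
    then obtain p where p: "x = ev p \<zeta>" by auto
    then show "- x \<in> range (\<lambda>p. ev p \<zeta>)"
      by (auto intro: range_eqI[of _ _ "- p"])
    show "inverse x \<in> range (\<lambda>p. ev p \<zeta>)"
    proof (cases "x = 0")
      case True
      then show ?thesis by (auto intro: range_eqI[of _ _ 0])
    next
      case False
      then have "\<not> F dvd p" using p root_iff_dvd zeta_in_R by blast
      then obtain u v where "u * F + v * p = 1" by (rule bezout_F)
      then have "ev (u * F + v * p) \<zeta> = 1" by simp
      then have "ev v \<zeta> * x = 1" using p root by (simp add: ev_F)
      then have "inverse x = ev v \<zeta>" by (metis inverse_unique mult.commute)
      then show ?thesis by blast
    qed
  qed
  moreover have "\<zeta> \<in> range (\<lambda>p. ev p \<zeta>)"
    by (rule range_eqI[of _ _ "[:0, 1:]"]) simp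
  ultimately show "E \<subseteq> range (\<lambda>p. ev p \<zeta>)"
    unfolding rat_adjoin_def by (intro hull_minimal) auto
next
  show "range (\<lambda>p. ev p \<zeta>) \<subseteq> E"
    unfolding rat_adjoin_def hull_def by (auto intro: is_subfield_poly)
qed

section \<open>Closure properties of the field and reduced coordinates\<close>

lemma ev_in_E: "ev p \<zeta> \<in> E"
  unfolding E_eq by blast

lemma E_of_rat: "of_rat q \<in> E"
  using ev_in_E[of "[:q:]"] by simp

lemma E_add: "x \<in> E \<Longrightarrow> y \<in> E \<Longrightarrow> x + y \<in> E"
  unfolding E_eq by (metis (no_types, lifting) ev_simps(1) rangeE rangeI)

lemma E_mult: "x \<in> E \<Longrightarrow> y \<in> E \<Longrightarrow> x * y \<in> E"
  unfolding E_eq by (metis (no_types, lifting) ev_simps(2) rangeE rangeI)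

lemma E_of_int: "of_int k \<in> E"
  using E_of_rat[of "of_int k"] by simp

lemma zeta_in_E: "\<zeta> \<in> E"
  using ev_in_E[of "[:0, 1:]"] by simp

lemma E_power: "x \<in> E \<Longrightarrow> x ^ k \<in> E"
  using E_of_int[of 1] by (induction k) (auto intro: E_mult)

lemma E_sum: "(\<And>i. i \<in> A \<Longrightarrow> g i \<in> E) \<Longrightarrow> sum g A \<in> E"
  using E_of_int[of 0] by (induction A rule: infinite_finite_induct) (auto intro: E_add)

text \<open>The remainder modulo \<open>F\<close> has the same value at \<zeta> and degree below
  \<open>n\<close>.\<close>

lemma E_reduced:
  assumes "x \<in> E"
  obtains c :: "nat \<Rightarrow> rat" where "x = (\<Sum>i<n. of_rat (c i) * \<zeta> ^ i)"
proof -
  from assms obtain p where p: "x = ev p \<zeta>" unfolding E_eq by blast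
  define q where "q = p mod F"
  have "ev p \<zeta> = ev (p div F * F + q) \<zeta>" by (simp add: q_def)
  then have x: "x = ev q \<zeta>" using p root by (simp only: ev_simps ev_F) simp
  have deg: "degree q < n"
    using degree_mod_less'[of F p] F_nonzero n_pos degree_F by (cases "q = 0") (auto simp: q_def)
  have "x = (\<Sum>i\<le>degree q. of_rat (coeff q i) * \<zeta> ^ i)"
    unfolding x by (simp add: poly_altdef degree_map_poly coeff_map_poly)
  also have "\<dots> = (\<Sum>i<n. of_rat (coeff q i) * \<zeta> ^ i)"
    by (rule sum.mono_neutral_left) (use deg in \<open>auto intro: coeff_eq_0\<close>)
  finally show ?thesis using that by blast
qed

section \<open>Roots, embeddings and the trace\<close>

lemma finite_R: "finite R"
  unfolding R_def using f_nonzero by (intro poly_roots_finite) auto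

text \<open>A double root would force \<open>F\<close> to divide \<open>pderiv F\<close>, which is
  nonzero and of smaller degree.\<close>

lemma rsquarefree_f: "rsquarefree (map_poly of_int f :: complex poly)"
proof -
  have "\<not> (poly (map_poly of_int f) x = 0 \<and> poly (pderiv (map_poly of_int f)) x = 0)" for x :: complex
  proof
    assume x: "poly (map_poly of_int f) x = 0 \<and> poly (pderiv (map_poly of_int f)) x = 0"
    have "map_poly of_rat (pderiv F) = (pderiv (map_poly of_int f) :: complex poly)"
      by (simp add: F_def of_rat_hom.map_poly_pderiv map_poly_map_poly o_def)
    then have "ev (pderiv F) x = 0" using x by simp
    moreover have "x \<in> R" using x by (simp add: R_def)
    ultimately have "F dvd pderiv F" using root_iff_dvd by blast
    moreover have "pderiv F \<noteq> 0" using degree_F n_pos by (simp add: pderiv_eq_0_iff)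
    ultimately have "degree F \<le> degree (pderiv F)" by (rule dvd_imp_degree_le)
    then show False using degree_F n_pos by (simp add: degree_pderiv)
  qed
  then show ?thesis
    unfolding rsquarefree_roots by blast
qed

lemma card_R: "card R = n"
  using rsquarefree_f rsquarefree_card_degree[of "map_poly of_int f :: complex poly"] f_nonzero
  by (simp add: R_def n_def)

text \<open>Any polynomial representing \<open>x\<close> may be chosen: by
  \<open>ev_eq_transfer\<close> its value at a root \<delta> is the same. The value outside
  \<open>E\<close> makes the map extensional.\<close>

definition emb :: "complex \<Rightarrow> complex \<Rightarrow> complex" where
  "emb \<delta> x = (if x \<in> E then ev (SOME p. x = ev p \<zeta>) \<delta> else undefined)"

lemma emb_ev:
  assumes "\<delta> \<in> R"
  shows "emb \<delta> (ev p \<zeta>) = ev p \<delta>"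
proof -
  have "ev p \<zeta> = ev (SOME q. ev p \<zeta> = ev q \<zeta>) \<zeta>"
    by (rule someI[of "\<lambda>q. ev p \<zeta> = ev q \<zeta>" p]) simp
  from ev_eq_transfer[OF this assms] show ?thesis
    by (simp add: emb_def ev_in_E)
qed

lemma emb_in_field_embeddings:
  assumes "\<delta> \<in> R"
  shows "emb \<delta> \<in> field_embeddings E"
proof -
  have "emb \<delta> 1 = 1" using emb_ev[OF assms, of 1] by simp
  moreover have "emb \<delta> (x + y) = emb \<delta> x + emb \<delta> y \<and> emb \<delta> (x * y) = emb \<delta> x * emb \<delta> y"
    if "x \<in> E" "y \<in> E" for x y
  proof -
    from that obtain p q where pq: "x = ev p \<zeta>" "y = ev q \<zeta>" unfolding E_eq by blast
    show ?thesis
      using emb_ev[OF assms, of "p + q"] emb_ev[OF assms, of "p * q"]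
      by (simp add: pq emb_ev[OF assms])
  qed
  ultimately show ?thesis
    unfolding field_embeddings_def by (auto simp: extensional_def emb_def)
qed

lemma field_embedding_of_rat:
  assumes "\<sigma> \<in> field_embeddings E"
  shows "\<sigma> (of_rat r) = of_rat r"
proof -
  have one: "\<sigma> 1 = 1" and add: "\<And>x y. x \<in> E \<Longrightarrow> y \<in> E \<Longrightarrow> \<sigma> (x + y) = \<sigma> x + \<sigma> y"
    and mult: "\<And>x y. x \<in> E \<Longrightarrow> y \<in> E \<Longrightarrow> \<sigma> (x * y) = \<sigma> x * \<sigma> y"
    using assms by (auto simp: field_embeddings_def)
  have zero: "\<sigma> 0 = 0"
    using add[of 0 0] E_of_int[of 0] by simp
  have nat: "\<sigma> (of_nat m) = of_nat m" for m
  proof (induction m)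
    case (Suc m)
    then show ?case
      using add[of 1 "of_nat m"] E_of_int[of 1] E_of_int[of "int m"] one by simp
  qed (simp add: zero)
  have int: "\<sigma> (of_int k) = of_int k" for k
  proof (cases "k \<ge> 0")
    case True
    then show ?thesis using nat[of "nat k"] by simp
  next
    case False
    then have "\<sigma> (of_int (-k)) = of_int (-k)" using nat[of "nat (-k)"] by simp
    moreover have "\<sigma> (of_int k + of_int (-k)) = \<sigma> (of_int k) + \<sigma> (of_int (-k))"
      by (intro add E_of_int)
    ultimately show ?thesis using zero by simp
  qed
  obtain a b where ab: "b > 0" "r = of_int a / of_int b"
    by (metis quotient_of_div quotient_of_denom_pos surj_pair)
  then have eq: "of_rat r * of_int b = (of_int a :: complex)"
    by (simp add: of_rat_divide)
  \<comment> \<open>\<open>field_embeddings\<close> speaks only of sums and products, so the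
    quotient is reached by clearing the denominator \<open>b\<close>.\<close>
  have "\<sigma> (of_rat r) * of_int b = of_int a"
    using mult[OF E_of_rat[of r] E_of_int[of b]] eq int by simp
  with eq ab(1) show ?thesis
    by (metis less_irrefl mult_cancel_right of_int_eq_0_iff)
qed

lemma field_embedding_ev:
  assumes "\<sigma> \<in> field_embeddings E"
  shows "\<sigma> (ev p \<zeta>) = ev p (\<sigma> \<zeta>)"
proof (induction p)
  case 0
  then show ?case using field_embedding_of_rat[OF assms, of 0] by simp
next
  case (pCons c p)
  have "\<sigma> (of_rat c + \<zeta> * ev p \<zeta>) = \<sigma> (of_rat c) + \<sigma> (\<zeta> * ev p \<zeta>)"
    "\<sigma> (\<zeta> * ev p \<zeta>) = \<sigma> \<zeta> * \<sigma> (ev p \<zeta>)"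
    using assms E_of_rat E_mult[OF zeta_in_E ev_in_E] zeta_in_E ev_in_E
    by (auto simp: field_embeddings_def)
  then show ?case
    using pCons field_embedding_of_rat[OF assms] by (simp add: map_poly_pCons)
qed

text \<open>An embedding is determined by the image of \<zeta>, which is again a root of
  \<open>F\<close>; conversely \<open>emb\<close> realizes every root as such an image.\<close>

lemma bij_betw_emb: "bij_betw emb R (field_embeddings E)"
proof (rule bij_betw_imageI)
  have emb_zeta: "emb \<delta> \<zeta> = \<delta>" if "\<delta> \<in> R" for \<delta>
    using emb_ev[OF that, of "[:0, 1:]"] by simp
  then show "inj_on emb R"
    by (metis inj_onI)
  show "emb ` R = field_embeddings E"
  proof (intro equalityI subsetI)
    fix \<sigma> assume \<sigma>: "\<sigma> \<in> field_embeddings E"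
    have "ev F (\<sigma> \<zeta>) = \<sigma> (ev F \<zeta>)"
      using field_embedding_ev[OF \<sigma>] by simp
    also have "\<dots> = 0"
      using field_embedding_of_rat[OF \<sigma>, of 0] root by (simp add: ev_F)
    finally have mem: "\<sigma> \<zeta> \<in> R"
      by (simp add: ev_F R_def)
    have "emb (\<sigma> \<zeta>) = \<sigma>"
    proof (rule extensionalityI[of _ E])
      show "emb (\<sigma> \<zeta>) \<in> extensional E" "\<sigma> \<in> extensional E"
        using \<sigma> by (auto simp: emb_def extensional_def field_embeddings_def)
      fix x assume "x \<in> E"
      then obtain p where "x = ev p \<zeta>" unfolding E_eq by blast
      then show "emb (\<sigma> \<zeta>) x = \<sigma> x"
        using emb_ev[OF mem] field_embedding_ev[OF \<sigma>] by simp
    qed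
    then show "\<sigma> \<in> emb ` R" using mem by force
  qed (auto intro: emb_in_field_embeddings)
qed

lemma field_trace_ev: "field_trace E (ev p \<zeta>) = (\<Sum>\<delta>\<in>R. ev p \<delta>)"
  unfolding field_trace_def
  by (subst sum.reindex_bij_betw[OF bij_betw_emb, symmetric]) (simp add: emb_ev)

lemma field_trace_sum:
  assumes "\<And>i. i \<in> A \<Longrightarrow> g i \<in> E"
  shows "field_trace E (\<Sum>i\<in>A. of_rat (c i) * g i) = (\<Sum>i\<in>A. of_rat (c i) * field_trace E (g i))"
proof -
  have "\<forall>i\<in>A. \<exists>p. g i = ev p \<zeta>"
    using assms unfolding E_eq by blast
  then obtain p where p: "\<And>i. i \<in> A \<Longrightarrow> g i = ev (p i) \<zeta>"
    by metis
  have eq: "(\<Sum>i\<in>A. of_rat (c i) * g i) = ev (\<Sum>i\<in>A. smult (c i) (p i)) \<zeta>"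
    by (simp add: ev_sum p)
  have "field_trace E (\<Sum>i\<in>A. of_rat (c i) * g i) = (\<Sum>\<delta>\<in>R. \<Sum>i\<in>A. of_rat (c i) * ev (p i) \<delta>)"
    unfolding eq field_trace_ev by (simp add: ev_sum)
  also have "\<dots> = (\<Sum>i\<in>A. \<Sum>\<delta>\<in>R. of_rat (c i) * ev (p i) \<delta>)"
    by (rule sum.swap)
  also have "\<dots> = (\<Sum>i\<in>A. of_rat (c i) * field_trace E (g i))"
    by (simp add: p field_trace_ev sum_distrib_left)
  finally show ?thesis .
qed

lemma enumerate_R:
  obtains d :: "nat \<Rightarrow> complex" where "bij_betw d {..<n} R"
  using ex_bij_betw_nat_finite[OF finite_R] card_R by (auto simp: atLeast0LessThan)

lemma det_vandermonde_roots_nonzero: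
  assumes "bij_betw d {..<n} R"
  shows "det (mat n n (\<lambda>(i, j). d i ^ j)) \<noteq> 0"
proof -
  have "d j \<noteq> d k" if "j < n" "k < j" for j k
    using bij_betw_imp_inj_on[OF assms] that unfolding inj_on_def by force
  then show ?thesis
    by (auto simp: det_vandermonde)
qed

text \<open>The trace of the matrix \<open>M\<close> of multiplication by \<open>x\<close> in the power basis is rational, and
  the Vandermonde matrix of the roots diagonalizes \<open>M\<close>.\<close>

lemma field_trace_rational:
  assumes "x \<in> E"
  shows "field_trace E x \<in> \<rat>"
proof -
  obtain p where p: "x = ev p \<zeta>"
    using assms unfolding E_eq by blast
  obtain d where d: "bij_betw d {..<n} R"
    by (rule enumerate_R)
  have "\<forall>i. \<exists>c :: nat \<Rightarrow> rat. x * \<zeta> ^ i = (\<Sum>j<n. of_rat (c j) * \<zeta> ^ j)"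
    using E_reduced[OF E_mult[OF assms E_power[OF zeta_in_E]]] by metis
  then obtain M :: "nat \<Rightarrow> nat \<Rightarrow> rat"
    where M: "\<And>i. x * \<zeta> ^ i = (\<Sum>j<n. of_rat (M i j) * \<zeta> ^ j)"
    by metis
  \<comment> \<open>At every root \<delta> the vector of powers of \<delta> is an eigenvector of
    \<open>M\<close> with eigenvalue \<open>ev p \<delta>\<close>.\<close>
  have M': "ev p \<delta> * \<delta> ^ i = (\<Sum>j<n. of_rat (M i j) * \<delta> ^ j)" if "\<delta> \<in> R" for i \<delta>
  proof -
    have "ev (p * [:0, 1:] ^ i) \<zeta> = ev (\<Sum>j<n. smult (M i j) ([:0, 1:] ^ j)) \<zeta>"
      using M[of i] unfolding p by (simp only: ev_simps ev_sum)
    from ev_eq_transfer[OF this that] show ?thesis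
      by (simp only: ev_simps ev_sum)
  qed
  let ?V = "mat n n (\<lambda>(i, j). d i ^ j)"
  have V: "?V \<in> carrier_mat n n" by simp
  from det_non_zero_imp_unit[OF V det_vandermonde_roots_nonzero[OF d], of "()"]
  obtain W where W: "W \<in> carrier_mat n n" "W * ?V = 1\<^sub>m n" "?V * W = 1\<^sub>m n"
    unfolding Units_def ring_mat_def by auto
  have WV: "(\<Sum>k<n. W $$ (i, k) * d k ^ j) = (if i = j then 1 else 0)" if "i < n" "j < n" for i j
    using arg_cong[OF W(2), of "\<lambda>A. A $$ (i, j)"] that W(1)
    by (simp add: scalar_prod_def atLeast0LessThan)
  have VW: "(\<Sum>j<n. d k ^ j * W $$ (j, k)) = 1" if "k < n" for k
    using arg_cong[OF W(3), of "\<lambda>A. A $$ (k, k)"] that W(1)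
    by (simp add: scalar_prod_def atLeast0LessThan)
  have dR: "d k \<in> R" if "k < n" for k
    using bij_betwE[OF d] that by simp
  \<comment> \<open>The trace of \<open>M\<close> is computed by inserting the identity as
    \<open>W * ?V\<close>. Then \<open>M'\<close> evaluates the sum over \<open>j\<close>, and
    \<open>VW\<close> leaves only the sum of the eigenvalues.\<close>
  have "of_rat (\<Sum>i<n. M i i) = (\<Sum>i<n. \<Sum>j<n. of_rat (M i j) * (if i = j then 1 else 0 :: complex))"
    by (simp add: of_rat_sum if_distrib[of "(*) _"] cong: if_cong)
  also have "\<dots> = (\<Sum>i<n. \<Sum>j<n. of_rat (M i j) * (\<Sum>k<n. W $$ (i, k) * d k ^ j))"
    by (intro sum.cong refl) (simp add: WV)
  also have "\<dots> = (\<Sum>i<n. \<Sum>j<n. \<Sum>k<n. W $$ (i, k) * (of_rat (M i j) * d k ^ j))"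
    by (simp add: sum_distrib_left mult_ac)
  also have "\<dots> = (\<Sum>i<n. \<Sum>k<n. \<Sum>j<n. W $$ (i, k) * (of_rat (M i j) * d k ^ j))"
    by (intro sum.cong refl sum.swap)
  also have "\<dots> = (\<Sum>i<n. \<Sum>k<n. W $$ (i, k) * (ev p (d k) * d k ^ i))"
    by (intro sum.cong refl) (simp add: M' dR sum_distrib_left)
  also have "\<dots> = (\<Sum>k<n. \<Sum>i<n. W $$ (i, k) * (ev p (d k) * d k ^ i))"
    by (rule sum.swap)
  also have "\<dots> = (\<Sum>k<n. ev p (d k) * (\<Sum>i<n. d k ^ i * W $$ (i, k)))"
    by (simp add: sum_distrib_left mult_ac)
  also have "\<dots> = (\<Sum>k<n. ev p (d k))"
    by (simp add: VW)
  also have "\<dots> = field_trace E x"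
    unfolding p field_trace_ev by (rule sum.reindex_bij_betw[OF d])
  finally show ?thesis
    by (metis Rats_of_rat)
qed

text \<open>If a monic \<open>g\<close> annihilates \<open>ev p \<zeta>\<close>, then
  \<open>g\<close> composed with \<open>p\<close> vanishes at \<zeta>, hence at \<delta>.\<close>

lemma algebraic_int_ev_transfer:
  assumes "algebraic_int (ev p \<zeta>)" "\<delta> \<in> R"
  shows "algebraic_int (ev p \<delta>)"
proof -
  from assms(1) obtain g :: "int poly"
    where g: "poly (map_poly of_int g) (ev p \<zeta>) = 0" "lead_coeff g = 1"
    unfolding algebraic_int_altdef_ipoly by blast
  have eq: "ev (map_poly of_int g \<circ>\<^sub>p p) x = poly (map_poly of_int g) (ev p x)" for x
    by (simp add: of_rat_hom.map_poly_pcompose poly_pcompose map_poly_map_poly o_def)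
  have "ev (map_poly of_int g \<circ>\<^sub>p p) \<zeta> = ev 0 \<zeta>"
    using g(1) by (simp add: eq)
  from ev_eq_transfer[OF this assms(2)] have "poly (map_poly of_int g) (ev p \<delta>) = 0"
    by (simp add: eq)
  with g(2) show ?thesis
    unfolding algebraic_int_altdef_ipoly by blast
qed

section \<open>The ring of integers and integrality of traces\<close>

abbreviation "\<O> \<equiv> ring_of_integers E"

text \<open>The trace is rational and, as a sum of conjugates of an algebraic integer, itself an
  algebraic integer; such numbers lie in \<int>.\<close>

lemma field_trace_Ints:
  assumes "x \<in> \<O>"
  shows "field_trace E x \<in> \<int>"
proof (rule rational_algebraic_int_is_int)
  have x: "x \<in> E" "algebraic_int x"
    using assms by (auto simp: ring_of_integers_def)
  then show "field_trace E x \<in> \<rat>"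
    by (intro field_trace_rational)
  obtain p where "x = ev p \<zeta>"
    using x unfolding E_eq by blast
  then show "algebraic_int (field_trace E x)"
    using x by (auto simp: field_trace_ev intro!: algebraic_int_sum algebraic_int_ev_transfer)
qed

lemma O_mult: "x \<in> \<O> \<Longrightarrow> y \<in> \<O> \<Longrightarrow> x * y \<in> \<O>"
  unfolding ring_of_integers_def by (auto intro: E_mult algebraic_int_add_mult)

lemma O_add: "x \<in> \<O> \<Longrightarrow> y \<in> \<O> \<Longrightarrow> x + y \<in> \<O>"
  unfolding ring_of_integers_def by (auto intro: E_add algebraic_int_add_mult)

lemma O_of_int: "of_int k \<in> \<O>"
  unfolding ring_of_integers_def by (auto intro: E_of_int algebraic_int_of_int)

lemma O_sum: "(\<And>i. i \<in> A \<Longrightarrow> g i \<in> \<O>) \<Longrightarrow> sum g A \<in> \<O>"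
  using O_of_int[of 0] by (induction A rule: infinite_finite_induct) (auto intro: O_add)

lemma O_subset_E: "\<O> \<subseteq> E"
  unfolding ring_of_integers_def by auto

section \<open>Discriminants of lists\<close>

lemma basis_disc_Ints:
  assumes "set bs \<subseteq> \<O>"
  shows "basis_disc E bs \<in> \<int>"
proof -
  have "\<forall>i<length bs. \<forall>j<length bs. \<exists>k. field_trace E (bs ! i * bs ! j) = of_int k"
    using field_trace_Ints[OF O_mult] assms by (metis Ints_cases nth_mem subsetD)
  then obtain g where g: "\<And>i j. i < length bs \<Longrightarrow> j < length bs \<Longrightarrow>
      field_trace E (bs ! i * bs ! j) = of_int (g i j)"
    by metis
  have "mat (length bs) (length bs) (\<lambda>(i, j). field_trace E (bs ! i * bs ! j)) =
    map_mat of_int (mat (length bs) (length bs) (\<lambda>(i, j). g i j))"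
    by (rule eq_matI) (auto simp: g)
  then show ?thesis
    unfolding basis_disc_def by simp
qed

text \<open>The trace form is bilinear over \<rat>, so the Gram matrices are related by
  \<open>?H = ?C * ?G * ?C\<^sup>T\<close>.\<close>

lemma basis_disc_change:
  fixes C :: "rat mat"
  assumes len: "length bs = m" "length cs = m" and cs: "set cs \<subseteq> E" and C: "C \<in> carrier_mat m m"
    and bs: "\<And>i. i < m \<Longrightarrow> bs ! i = (\<Sum>j<m. of_rat (C $$ (i, j)) * cs ! j)"
  shows "basis_disc E bs = (of_rat (det C))\<^sup>2 * basis_disc E cs"
proof -
  let ?C = "map_mat of_rat C :: complex mat"
  let ?G = "mat m m (\<lambda>(i, j). field_trace E (cs ! i * cs ! j))"
  let ?H = "mat m m (\<lambda>(i, j). field_trace E (bs ! i * bs ! j))"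
  have mem: "cs ! j \<in> E" if "j < m" for j
    using cs len(2) that by auto
  have "?H = ?C * ?G * ?C\<^sup>T"
  proof (rule eq_matI)
    fix i j assume "i < dim_row (?C * ?G * ?C\<^sup>T)" "j < dim_col (?C * ?G * ?C\<^sup>T)"
    then have ij: "i < m" "j < m" using C by auto
    have "bs ! i * bs ! j = (\<Sum>l<m. of_rat (C $$ (j, l)) * (\<Sum>k<m. of_rat (C $$ (i, k)) * (cs ! k * cs ! l)))"
      by (simp add: bs ij sum_distrib_left sum_distrib_right mult_ac)
    also have "field_trace E \<dots> = (\<Sum>l<m. of_rat (C $$ (j, l)) *
        (\<Sum>k<m. of_rat (C $$ (i, k)) * field_trace E (cs ! k * cs ! l)))"
    proof (subst field_trace_sum)
      show "(\<Sum>k<m. of_rat (C $$ (i, k)) * (cs ! k * cs ! l)) \<in> E" if "l \<in> {..<m}" for l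
        using that by (intro E_sum E_mult E_of_rat mem) auto
      have "field_trace E (\<Sum>k<m. of_rat (C $$ (i, k)) * (cs ! k * cs ! l)) =
          (\<Sum>k<m. of_rat (C $$ (i, k)) * field_trace E (cs ! k * cs ! l))" if "l < m" for l
        using that by (intro field_trace_sum E_mult mem) auto
      then show "(\<Sum>l<m. of_rat (C $$ (j, l)) *
            field_trace E (\<Sum>k<m. of_rat (C $$ (i, k)) * (cs ! k * cs ! l))) =
          (\<Sum>l<m. of_rat (C $$ (j, l)) *
            (\<Sum>k<m. of_rat (C $$ (i, k)) * field_trace E (cs ! k * cs ! l)))"
        by simp
    qed
    finally have "field_trace E (bs ! i * bs ! j) = (\<Sum>l<m. of_rat (C $$ (j, l)) *
        (\<Sum>k<m. of_rat (C $$ (i, k)) * field_trace E (cs ! k * cs ! l)))" .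
    then show "?H $$ (i, j) = (?C * ?G * ?C\<^sup>T) $$ (i, j)"
      using ij C by (simp add: scalar_prod_def atLeast0LessThan mult.commute)
  qed (use C in auto)
  then have "det ?H = det ?C * det ?G * det (?C\<^sup>T)"
    using C by (simp add: det_mult[of _ m])
  also have "det (?C\<^sup>T) = det ?C"
    using C by (intro det_transpose) auto
  finally show ?thesis
    unfolding basis_disc_def len by (simp add: power2_eq_square mult_ac)
qed

abbreviation "powers \<equiv> map (\<lambda>i. \<zeta> ^ i) [0..<n]"

text \<open>The trace of \<open>\<zeta> ^ i * \<zeta> ^ j\<close> is a power sum of the roots, so
  the Gram matrix is \<open>?V\<^sup>T * ?V\<close>. Since differences are squared, they can be
  oriented as in \<open>binary_form_disc\<close>.\<close>

lemma basis_disc_powers: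
  assumes "bij_betw d {..<n} R"
  shows "basis_disc E powers = (\<Prod>j<n. \<Prod>k<j. (d k - d j)\<^sup>2)"
proof -
  let ?V = "mat n n (\<lambda>(i, j). d i ^ j)"
  let ?G = "mat n n (\<lambda>(i, j). field_trace E (powers ! i * powers ! j))"
  have "field_trace E (\<zeta> ^ i * \<zeta> ^ j) = (\<Sum>k<n. d k ^ i * d k ^ j)" for i j
  proof -
    have eq: "\<zeta> ^ i * \<zeta> ^ j = ev ([:0, 1:] ^ i * [:0, 1:] ^ j) \<zeta>"
      by (simp only: ev_simps)
    have "field_trace E (\<zeta> ^ i * \<zeta> ^ j) = (\<Sum>\<delta>\<in>R. \<delta> ^ i * \<delta> ^ j)"
      unfolding eq field_trace_ev by (rule sum.cong) (simp_all only: ev_simps)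
    then show ?thesis
      using sum.reindex_bij_betw[OF assms, of "\<lambda>x. x ^ i * x ^ j"] by simp
  qed
  then have "?G = ?V\<^sup>T * ?V"
    by (intro eq_matI) (auto simp: scalar_prod_def atLeast0LessThan)
  then have "det ?G = (det ?V)\<^sup>2"
    by (simp add: det_mult[of _ n] det_transpose[of _ n] power2_eq_square)
  also have "\<dots> = (\<Prod>j<n. \<Prod>k<j. (d k - d j)\<^sup>2)"
    by (simp add: det_vandermonde prod_power_distrib power2_commute)
  finally show ?thesis
    unfolding basis_disc_def by simp
qed

lemma basis_disc_powers_nonzero: "basis_disc E powers \<noteq> 0"
proof -
  obtain d where d: "bij_betw d {..<n} R"
    by (rule enumerate_R)
  have "d k \<noteq> d j" if "j < n" "k < j" for j k
    using bij_betw_imp_inj_on[OF d] that unfolding inj_on_def by force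
  then show ?thesis
    unfolding basis_disc_powers[OF d] by (auto dest: lessThan_iff[THEN iffD1])
qed

text \<open>By \<open>basis_disc_change\<close> the matrix \<open>?P\<close> of coordinates in the
  powers of \<zeta> is invertible; its inverse \<open>Q\<close> writes the powers in terms of
  \<open>bs\<close>.\<close>

lemma rational_span_if_basis_disc_nonzero:
  assumes len: "length bs = n" and bs: "set bs \<subseteq> E" and disc: "basis_disc E bs \<noteq> 0" and "x \<in> E"
  obtains q :: "nat \<Rightarrow> rat" where "x = (\<Sum>i<n. of_rat (q i) * bs ! i)"
proof -
  have "\<forall>i<n. \<exists>c :: nat \<Rightarrow> rat. bs ! i = (\<Sum>j<n. of_rat (c j) * \<zeta> ^ j)"
    using E_reduced bs len by (metis nth_mem subsetD)
  then obtain P :: "nat \<Rightarrow> nat \<Rightarrow> rat"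
    where P: "\<And>i. i < n \<Longrightarrow> bs ! i = (\<Sum>j<n. of_rat (P i j) * \<zeta> ^ j)"
    by metis
  let ?P = "mat n n (\<lambda>(i, j). P i j)"
  have "basis_disc E bs = (of_rat (det ?P))\<^sup>2 * basis_disc E powers"
    by (rule basis_disc_change[OF len]) (auto simp: P intro!: E_power zeta_in_E)
  with disc have "det ?P \<noteq> 0" by auto
  from det_non_zero_imp_unit[OF _ this, of n "()"]
  obtain Q where Q: "Q \<in> carrier_mat n n" "Q * ?P = 1\<^sub>m n"
    unfolding Units_def ring_mat_def by auto
  have QP: "(\<Sum>k<n. Q $$ (i, k) * P k j) = (if i = j then 1 else 0)" if "i < n" "j < n" for i j
    using arg_cong[OF Q(2), of "\<lambda>A. A $$ (i, j)"] that Q(1)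
    by (simp add: scalar_prod_def atLeast0LessThan)
  have pow: "\<zeta> ^ i = (\<Sum>k<n. of_rat (Q $$ (i, k)) * bs ! k)" if "i < n" for i
  proof -
    have "(\<Sum>k<n. of_rat (Q $$ (i, k)) * bs ! k) =
        (\<Sum>k<n. \<Sum>j<n. of_rat (Q $$ (i, k) * P k j) * \<zeta> ^ j)"
      by (simp add: P sum_distrib_left of_rat_mult mult.assoc)
    also have "\<dots> = (\<Sum>j<n. \<Sum>k<n. of_rat (Q $$ (i, k) * P k j) * \<zeta> ^ j)"
      by (rule sum.swap)
    also have "\<dots> = (\<Sum>j<n. of_rat (\<Sum>k<n. Q $$ (i, k) * P k j) * \<zeta> ^ j)"
      by (simp add: of_rat_sum sum_distrib_right)
    also have "\<dots> = (\<Sum>j<n. of_rat (if i = j then 1 else 0) * \<zeta> ^ j)"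
      by (intro sum.cong refl) (use that QP in simp)
    also have "\<dots> = \<zeta> ^ i"
      using that by (simp add: if_distrib[of "\<lambda>t. of_rat t * _"] cong: if_cong)
    finally show ?thesis by simp
  qed
  obtain c :: "nat \<Rightarrow> rat" where "x = (\<Sum>i<n. of_rat (c i) * \<zeta> ^ i)"
    using E_reduced[OF assms(4)] .
  also have "\<dots> = (\<Sum>i<n. \<Sum>k<n. of_rat (c i * Q $$ (i, k)) * bs ! k)"
    by (intro sum.cong refl) (simp add: pow sum_distrib_left of_rat_mult mult.assoc)
  also have "\<dots> = (\<Sum>k<n. \<Sum>i<n. of_rat (c i * Q $$ (i, k)) * bs ! k)"
    by (rule sum.swap)
  also have "\<dots> = (\<Sum>k<n. of_rat (\<Sum>i<n. c i * Q $$ (i, k)) * bs ! k)"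
    by (simp add: of_rat_sum sum_distrib_right)
  finally show ?thesis using that[of "\<lambda>k. \<Sum>i<n. c i * Q $$ (i, k)"] by simp
qed

text \<open>The coefficients of a rational relation form a vector in the kernel of the Gram matrix,
  which is invertible.\<close>

lemma independent_if_basis_disc_nonzero:
  fixes c :: "nat \<Rightarrow> rat"
  assumes bs: "set bs \<subseteq> E" and disc: "basis_disc E bs \<noteq> 0"
    and zero: "(\<Sum>i<length bs. of_rat (c i) * bs ! i) = 0" and "i < length bs"
  shows "c i = 0"
proof -
  define m where "m = length bs"
  let ?G = "mat m m (\<lambda>(i, j). field_trace E (bs ! i * bs ! j))"
  let ?v = "vec m (\<lambda>i. of_rat (c i)) :: complex vec"
  have mem: "bs ! j \<in> E" if "j < m" for j
    using bs that by (auto simp: m_def)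
  have "?G *\<^sub>v ?v = 0\<^sub>v m"
  proof (rule eq_vecI)
    fix i assume "i < dim_vec (0\<^sub>v m :: complex vec)"
    then have i: "i < m" by simp
    have "(?G *\<^sub>v ?v) $ i = (\<Sum>j<m. of_rat (c j) * field_trace E (bs ! i * bs ! j))"
      using i by (simp add: scalar_prod_def atLeast0LessThan mult.commute)
    also have "\<dots> = field_trace E (\<Sum>j<m. of_rat (c j) * (bs ! i * bs ! j))"
      using i by (intro field_trace_sum[symmetric] E_mult mem) auto
    also have "(\<Sum>j<m. of_rat (c j) * (bs ! i * bs ! j)) = bs ! i * (\<Sum>j<m. of_rat (c j) * bs ! j)"
      by (simp add: sum_distrib_left mult_ac)
    also have "\<dots> = 0"
      using zero by (simp add: m_def)
    also have "field_trace E 0 = 0"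
      using field_trace_ev[of 0] by simp
    finally show "(?G *\<^sub>v ?v) $ i = 0\<^sub>v m $ i"
      using i by simp
  qed simp
  moreover have "det ?G \<noteq> 0"
    using disc by (simp add: basis_disc_def m_def)
  moreover have "?v \<in> carrier_vec m" "?G \<in> carrier_mat m m"
    by auto
  ultimately have "?v = 0\<^sub>v m"
    using det_0_iff_vec_prod_zero[of ?G m] by blast
  then have "?v $ i = 0"
    using assms(4) by (simp add: m_def)
  then show ?thesis
    using assms(4) by (simp add: m_def)
qed

section \<open>Integral bases\<close>

lemma integral_basis_if_minimal_disc:
  assumes len: "length bs = n" and bs: "set bs \<subseteq> \<O>" and disc: "basis_disc E bs \<noteq> 0"
    and min: "\<And>cs. length cs = n \<Longrightarrow> set cs \<subseteq> \<O> \<Longrightarrow> basis_disc E cs \<noteq> 0 \<Longrightarrow>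
      cmod (basis_disc E bs) \<le> cmod (basis_disc E cs)"
  shows "is_integral_basis E bs"
proof -
  have bs_E: "set bs \<subseteq> E"
    using bs O_subset_E by blast
  have mem: "bs ! i \<in> \<O>" if "i < n" for i
    using bs len that by auto
  have "\<exists>!cs :: int list. length cs = length bs \<and> x = (\<Sum>i<length bs. of_int (cs ! i) * bs ! i)"
    if x: "x \<in> \<O>" for x
  proof -
    obtain q :: "nat \<Rightarrow> rat" where q: "x = (\<Sum>i<n. of_rat (q i) * bs ! i)"
      using rational_span_if_basis_disc_nonzero[OF len bs_E disc] x O_subset_E by blast
    have q_int: "q k \<in> \<int>" if k: "k < n" for k
    proof (rule ccontr)
      assume nint: "q k \<notin> \<int>"
      define y where "y = x - of_int \<lfloor>q k\<rfloor> * bs ! k"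
      have "y = x + of_int (- \<lfloor>q k\<rfloor>) * bs ! k"
        by (simp add: y_def)
      then have y: "y \<in> \<O>"
        using x mem[OF k] by (auto intro: O_add O_mult O_of_int simp del: of_int_minus)
      \<comment> \<open>\<open>q'\<close> gives the coordinates of \<open>y\<close>; only the one at
        \<open>k\<close> differs from \<open>q\<close>, and it equals
        \<open>frac (q k)\<close>.\<close>
      define q' where "q' j = q j - (if j = k then of_int \<lfloor>q k\<rfloor> else 0)" for j
      define cs where "cs = bs[k := y]"
      \<comment> \<open>Exchanging \<open>bs ! k\<close> for \<open>y\<close> changes only row
        \<open>k\<close> of the identity, so the determinant is the coordinate of \<open>y\<close>
        at \<open>k\<close>.\<close>
      define C where "C = mat n n (\<lambda>(i, j). if i = k then q' j else if i = j then 1 else 0)"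
      have det: "det C = frac (q k)"
        unfolding C_def using det_replace_row_one[OF k, of q'] by (simp add: q'_def frac_def)
      \<comment> \<open>Positivity keeps the new discriminant nonzero, so that \<open>min\<close>
        applies; the upper bound makes it strictly smaller in absolute value.\<close>
      have frac: "0 < frac (q k)" "frac (q k) < 1"
        using nint by (auto simp: frac_gt_0_iff frac_lt_1)
      have y_eq: "y = (\<Sum>j<n. of_rat (q' j) * bs ! j)"
        using k by (simp add: y_def q q'_def of_rat_diff left_diff_distrib sum_subtractf
            if_distrib[of of_rat] if_distrib[of "\<lambda>t. t * _"] cong: if_cong)
      have "basis_disc E cs = (of_rat (det C))\<^sup>2 * basis_disc E bs"
      proof (rule basis_disc_change[of _ n])
        fix i assume i: "i < n"
        show "cs ! i = (\<Sum>j<n. of_rat (C $$ (i, j)) * bs ! j)"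
        proof (cases "i = k")
          case True
          then show ?thesis using i len by (simp add: cs_def C_def y_eq)
        next
          case False
          then show ?thesis using i len
            by (simp add: cs_def C_def if_distrib[of of_rat] if_distrib[of "\<lambda>t. t * _"] cong: if_cong)
        qed
      qed (use len bs_E in \<open>auto simp: cs_def C_def\<close>)
      then have cs_disc: "basis_disc E cs = of_rat ((frac (q k))\<^sup>2) * basis_disc E bs"
        by (simp add: det of_rat_power)
      have "(frac (q k))\<^sup>2 < 1"
        using frac by (simp add: power_less_one_iff abs_square_less_1)
      then have "cmod (of_rat ((frac (q k))\<^sup>2)) < 1"
        by (simp add: complex_of_rat_eq_of_real)
      then have "cmod (basis_disc E cs) < cmod (basis_disc E bs)"
        unfolding cs_disc norm_mult using disc by simp
      moreover have "cmod (basis_disc E bs) \<le> cmod (basis_disc E cs)"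
      proof (rule min)
        show "length cs = n" using len by (simp add: cs_def)
        show "set cs \<subseteq> \<O>"
          using set_update_subset_insert[of bs k y] bs y by (auto simp: cs_def)
        show "basis_disc E cs \<noteq> 0" using cs_disc disc frac by simp
      qed
      ultimately show False by simp
    qed
    define cs where "cs = map (\<lambda>i. \<lfloor>q i\<rfloor>) [0..<n]"
    have floor: "of_rat (q i) = (of_int \<lfloor>q i\<rfloor> :: complex)" if "i < n" for i
      using q_int[OF that] by (auto elim: Ints_cases)
    show ?thesis
    proof (rule ex1I[of _ cs])
      show "length cs = length bs \<and> x = (\<Sum>i<length bs. of_int (cs ! i) * bs ! i)"
        unfolding q by (auto simp: len cs_def floor)
    next
      fix ds assume ds: "length ds = length bs \<and> x = (\<Sum>i<length bs. of_int (ds ! i) * bs ! i)"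
      then have "(\<Sum>i<length bs. of_rat (of_int (ds ! i) - q i) * bs ! i) = 0"
        using q len by (simp add: of_rat_diff left_diff_distrib sum_subtractf)
      from independent_if_basis_disc_nonzero[OF bs_E disc this]
      have "of_int (ds ! i) = q i" if "i < n" for i
        using that len by simp
      then show "ds = cs"
        using ds len by (intro nth_equalityI) (auto simp: cs_def, metis floor_of_int)
    qed
  qed
  then show ?thesis
    unfolding is_integral_basis_def using bs by blast
qed

section \<open>Independence of the discriminant from the choice of the integral basis\<close>

lemma integral_basis_independent:
  fixes c d :: "nat \<Rightarrow> int"
  assumes basis: "is_integral_basis E bs" and i: "i < length bs"
    and eq: "(\<Sum>i<length bs. of_int (c i) * bs ! i) = (\<Sum>i<length bs. of_int (d i) * bs ! i)"
  shows "c i = d i"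
proof -
  define x where "x = (\<Sum>i<length bs. of_int (c i) * bs ! i)"
  have "x \<in> \<O>"
    unfolding x_def using basis by (intro O_sum O_mult O_of_int) (auto simp: is_integral_basis_def)
  then have ex1: "\<exists>!cs :: int list. length cs = length bs \<and> x = (\<Sum>i<length bs. of_int (cs ! i) * bs ! i)"
    using basis unfolding is_integral_basis_def by blast
  \<comment> \<open>Uniqueness in \<open>is_integral_basis\<close> concerns coefficient lists, so
    both functions are tabulated as lists of full length.\<close>
  let ?c = "map c [0..<length bs]" and ?d = "map d [0..<length bs]"
  have "length ?c = length bs \<and> x = (\<Sum>i<length bs. of_int (?c ! i) * bs ! i)"
    "length ?d = length bs \<and> x = (\<Sum>i<length bs. of_int (?d ! i) * bs ! i)"
    using eq by (auto simp: x_def)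
  with ex1 have "?c = ?d" by blast
  then show ?thesis
    using i by (metis add_0 diff_zero length_upt nth_map nth_upt)
qed

lemma integral_basis_coeffs:
  assumes "is_integral_basis E bs" "set cs \<subseteq> \<O>"
  obtains A :: "nat \<Rightarrow> nat \<Rightarrow> int"
  where "\<And>i. i < length cs \<Longrightarrow> cs ! i = (\<Sum>j<length bs. of_int (A i j) * bs ! j)"
proof -
  have "\<forall>i<length cs. \<exists>a :: nat \<Rightarrow> int. cs ! i = (\<Sum>j<length bs. of_int (a j) * bs ! j)"
    using assms unfolding is_integral_basis_def by (metis nth_mem subsetD)
  then show ?thesis using that by metis
qed

text \<open>Expanding \<open>bs\<close> in \<open>cs\<close> and back reproduces each element, and
  independence compares coefficients. The two lengths are not yet known to agree, so
  \<open>A\<close> and \<open>B\<close> may be rectangular.\<close>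

lemma integral_basis_inverse:
  fixes A B :: "nat \<Rightarrow> nat \<Rightarrow> int"
  assumes basis: "is_integral_basis E bs"
    and A: "\<And>i. i < length bs \<Longrightarrow> bs ! i = (\<Sum>j<length cs. of_int (A i j) * cs ! j)"
    and B: "\<And>i. i < length cs \<Longrightarrow> cs ! i = (\<Sum>j<length bs. of_int (B i j) * bs ! j)"
    and ij: "i < length bs" "j < length bs"
  shows "(\<Sum>k<length cs. A i k * B k j) = (if i = j then 1 else 0)"
proof -
  have "(\<Sum>j<length bs. of_int (\<Sum>k<length cs. A i k * B k j) * bs ! j) =
      (\<Sum>j<length bs. \<Sum>k<length cs. of_int (A i k * B k j) * bs ! j)"
    by (simp add: sum_distrib_right)
  also have "\<dots> = (\<Sum>k<length cs. \<Sum>j<length bs. of_int (A i k * B k j) * bs ! j)"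
    by (rule sum.swap)
  also have "\<dots> = (\<Sum>k<length cs. of_int (A i k) * (\<Sum>j<length bs. of_int (B k j) * bs ! j))"
    by (simp add: sum_distrib_left mult.assoc)
  also have "\<dots> = (\<Sum>k<length cs. of_int (A i k) * cs ! k)"
    by (simp add: B)
  also have "\<dots> = bs ! i"
    using A ij by simp
  also have "\<dots> = (\<Sum>j<length bs. of_int (if i = j then 1 else 0) * bs ! j)"
    using ij by (simp add: if_distrib[of of_int] if_distrib[of "\<lambda>t. t * _"] cong: if_cong)
  finally show ?thesis
    by (rule integral_basis_independent[OF basis ij(2)])
qed

text \<open>The equality of the lengths comes from \<open>tr (A B) = tr (B A)\<close>.\<close>

lemma integral_bases_same_disc:
  assumes bs: "is_integral_basis E bs" and cs: "is_integral_basis E cs"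
  shows "basis_disc E bs = basis_disc E cs"
proof -
  define m where "m = length bs"
  have bs_O: "set bs \<subseteq> \<O>" and cs_O: "set cs \<subseteq> \<O>"
    using bs cs by (auto simp: is_integral_basis_def)
  obtain A :: "nat \<Rightarrow> nat \<Rightarrow> int"
    where A: "\<And>i. i < length bs \<Longrightarrow> bs ! i = (\<Sum>j<length cs. of_int (A i j) * cs ! j)"
    using integral_basis_coeffs[OF cs bs_O] by metis
  obtain B :: "nat \<Rightarrow> nat \<Rightarrow> int"
    where B: "\<And>i. i < length cs \<Longrightarrow> cs ! i = (\<Sum>j<length bs. of_int (B i j) * bs ! j)"
    using integral_basis_coeffs[OF bs cs_O] by metis
  note AB = integral_basis_inverse[OF bs A B]
  note BA = integral_basis_inverse[OF cs B A]
  have "int (length bs) = (\<Sum>i<length bs. \<Sum>k<length cs. A i k * B k i)"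
    by (simp add: AB)
  also have "\<dots> = (\<Sum>k<length cs. \<Sum>i<length bs. B k i * A i k)"
    by (subst sum.swap) (simp add: mult.commute)
  also have "\<dots> = int (length cs)"
    by (simp add: BA)
  finally have len: "length bs = m" "length cs = m"
    by (simp_all add: m_def)
  let ?A = "mat m m (\<lambda>(i, j). A i j)" and ?B = "mat m m (\<lambda>(i, j). B i j)"
  have "?A * ?B = 1\<^sub>m m"
    by (intro eq_matI) (auto simp: scalar_prod_def atLeast0LessThan AB[unfolded len])
  then have "det ?A * det ?B = 1"
    using det_mult[of ?A m ?B] by simp
  \<comment> \<open>The determinants are integers with product 1, hence units; the sign disappears
    in the square.\<close>
  then have "\<bar>det ?A\<bar> = 1"
    by (auto simp: zmult_eq_1_iff)
  then have det: "(det ?A)\<^sup>2 = 1"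
    by (metis power2_abs one_power2)
  let ?C = "map_mat of_int ?A :: rat mat"
  have "basis_disc E bs = (of_rat (det ?C))\<^sup>2 * basis_disc E cs"
    by (rule basis_disc_change[OF len]) (use cs_O O_subset_E A len in auto)
  also have "(of_rat (det ?C))\<^sup>2 = (of_int ((det ?A)\<^sup>2) :: complex)"
    by simp
  finally show ?thesis
    by (simp add: det)
qed

text \<open>Resolves the definite description in \<open>field_disc\<close>: the value is a rational
  integer by \<open>basis_disc_Ints\<close> and unique by
  \<open>integral_bases_same_disc\<close>.\<close>

lemma field_disc_eq:
  assumes "is_integral_basis E bs"
  shows "of_int (field_disc E) = basis_disc E bs"
proof -
  obtain d where d: "basis_disc E bs = of_int d"
    using basis_disc_Ints[of bs] assms by (auto simp: is_integral_basis_def elim: Ints_cases)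
  have "field_disc E = d"
    unfolding field_disc_def
  proof (rule the_equality)
    show "\<exists>bs. is_integral_basis E bs \<and> of_int d = basis_disc E bs"
      using assms d by auto
    fix e assume "\<exists>bs. is_integral_basis E bs \<and> of_int e = basis_disc E bs"
    then obtain cs where "is_integral_basis E cs" "of_int e = basis_disc E cs" by blast
    then have "(of_int e :: complex) = of_int d"
      using integral_bases_same_disc[OF assms] d by simp
    then show "e = d" by simp
  qed
  then show ?thesis using d by simp
qed

text \<open>The existence of an integral basis is not presupposed: \<open>bs\<close> itself is a
  candidate, so a minimal candidate exists and is an integral basis. Its discriminant is
  \<open>field_disc E\<close>, hence that of \<open>bs\<close>, which is therefore minimal as
  well.\<close>

lemma integral_basis_if_disc_eq_field_disc:
  assumes len: "length bs = n" and bs: "set bs \<subseteq> \<O>" and disc: "basis_disc E bs \<noteq> 0"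
    and eq: "basis_disc E bs = of_int (field_disc E)"
  shows "is_integral_basis E bs"
proof -
  let ?P = "\<lambda>cs. length cs = n \<and> set cs \<subseteq> \<O> \<and> basis_disc E cs \<noteq> 0"
  obtain cs where cs: "?P cs"
    and least: "\<And>ds. ?P ds \<Longrightarrow> nat \<lfloor>cmod (basis_disc E cs)\<rfloor> \<le> nat \<lfloor>cmod (basis_disc E ds)\<rfloor>"
    using ex_has_least_nat[of ?P bs "\<lambda>cs. nat \<lfloor>cmod (basis_disc E cs)\<rfloor>"] len bs disc by blast
  \<comment> \<open>Absolute values of these discriminants are natural numbers, so rounding down in
    the minimization loses nothing.\<close>
  have cmod_eq: "cmod (basis_disc E ds) = real (nat \<lfloor>cmod (basis_disc E ds)\<rfloor>)" if "?P ds" for ds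
    using basis_disc_Ints[of ds] that by (auto elim!: Ints_cases)
  have min: "cmod (basis_disc E cs) \<le> cmod (basis_disc E ds)" if "?P ds" for ds
    using least[OF that] cmod_eq[OF that] cmod_eq[OF cs] by linarith
  have "is_integral_basis E cs"
    using cs min by (intro integral_basis_if_minimal_disc) auto
  then have "basis_disc E bs = basis_disc E cs"
    using field_disc_eq eq by simp
  then show ?thesis
    using min by (intro integral_basis_if_minimal_disc[OF len bs disc]) auto
qed

end

section \<open>Forms and the elements \<open>omega\<close>\<close>

locale int_form_root = int_poly_root +
  fixes a :: "nat \<Rightarrow> int"
  assumes f_eq: "f = (\<Sum>k=1..n+1. monom (a k) (n + 1 - k))"
begin

section \<open>Coefficients and discriminant of the form\<close>

lemma poly_f: "poly (map_poly of_int f) x = (\<Sum>k=1..n+1. of_int (a k) * x ^ (n + 1 - k))"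
  for x :: complex
proof -
  have "(map_poly of_int f :: complex poly) = (\<Sum>k=1..n+1. monom (of_int (a k)) (n + 1 - k))"
    by (subst f_eq) (simp add: of_int_poly_hom.hom_sum map_poly_monom del: sum.cl_ivl_Suc)
  then show ?thesis
    by (simp add: poly_sum poly_monom del: sum.cl_ivl_Suc)
qed

lemma lead_coeff_f: "coeff f n = a 1"
proof -
  have "coeff f n = (\<Sum>k=1..n+1. if k = 1 then a k else 0)"
    by (subst f_eq, unfold coeff_sum coeff_monom, rule sum.cong) auto
  also have "\<dots> = a 1"
    by (simp add: sum.delta del: sum.cl_ivl_Suc)
  finally show ?thesis .
qed

lemma a1_nonzero: "a 1 \<noteq> 0"
  using lead_coeff_f f_nonzero unfolding n_def by (metis leading_coeff_0_iff)

lemma binary_form_disc_eq: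
  "binary_form_disc n a = of_int (a 1) ^ (2 * (n - 1)) * basis_disc E powers"
proof -
  have form: "binary_form n a x 1 = poly (map_poly of_int f) x" for x
    unfolding binary_form_def poly_f by simp
  show ?thesis
    unfolding binary_form_disc_def
  proof (rule the_equality)
    obtain d where d: "bij_betw d {..<n} R"
      by (rule enumerate_R)
    have "(map_poly of_int f :: complex poly) = smult (of_int (a 1)) (\<Prod>z\<in>R. [:- z, 1:])"
      using complex_poly_decompose_rsquarefree[OF rsquarefree_f] lead_coeff_f
      by (simp add: R_def n_def)
    then have "poly (map_poly of_int f) x = of_int (a 1) * (\<Prod>z\<in>R. x - z)" for x :: complex
      by (simp add: poly_prod)
    then have "poly (map_poly of_int f) x = of_int (a 1) * (\<Prod>i<n. x - d i)" for x :: complex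
      using prod.reindex_bij_betw[OF d, of "\<lambda>z. x - z"] by simp
    moreover have "(\<Prod>j<n. \<Prod>k<j. (d k - d j)\<^sup>2) =
        (\<Prod>j<n. \<Prod>k<j. (map d [0..<n] ! k - map d [0..<n] ! j)\<^sup>2)"
      by (intro prod.cong refl) auto
    ultimately show "\<exists>ds. length ds = n \<and>
        (\<forall>x. binary_form n a x 1 = of_int (a 1) * (\<Prod>i<n. x - ds ! i)) \<and>
        of_int (a 1) ^ (2 * (n - 1)) * basis_disc E powers =
        of_int (a 1) ^ (2 * (n - 1)) * (\<Prod>j<n. \<Prod>i<j. (ds ! i - ds ! j)\<^sup>2)"
      using basis_disc_powers[OF d] by (intro exI[of _ "map d [0..<n]"]) (simp add: form)
  next
    fix e assume "\<exists>ds. length ds = n \<and>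
        (\<forall>x. binary_form n a x 1 = of_int (a 1) * (\<Prod>i<n. x - ds ! i)) \<and>
        e = of_int (a 1) ^ (2 * (n - 1)) * (\<Prod>j<n. \<Prod>i<j. (ds ! i - ds ! j)\<^sup>2)"
    then obtain ds where ds: "\<And>x. binary_form n a x 1 = of_int (a 1) * (\<Prod>i<n. x - ds ! i)"
      "e = of_int (a 1) ^ (2 * (n - 1)) * (\<Prod>j<n. \<Prod>i<j. (ds ! i - ds ! j)\<^sup>2)"
      by blast
    have image: "(!) ds ` {..<n} = R"
      unfolding R_def form[symmetric] ds(1) using a1_nonzero by auto
    then have "inj_on ((!) ds) {..<n}"
      using card_R by (intro eq_card_imp_inj_on) auto
    then have "bij_betw ((!) ds) {..<n} R"
      using image by (simp add: bij_betw_def)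
    from basis_disc_powers[OF this]
    show "e = of_int (a 1) ^ (2 * (n - 1)) * basis_disc E powers"
      using ds(2) by simp
  qed
qed

text \<open>Extends the formula for \<open>omega\<close> with \<open>j \<ge> 2\<close> to
  \<open>j = 1\<close>. The value at \<open>j = n\<close> lies beyond the list of the
  \<open>omega\<close>, but is a rational integer because \<zeta> is a root.\<close>

definition "\<gamma> j = (\<Sum>k=1..j. of_int (a k) * \<zeta> ^ (j + 1 - k))"

lemma gamma_1: "\<gamma> 1 = of_int (a 1) * \<zeta>"
  by (simp add: \<gamma>_def)

text \<open>One step of Horner's scheme for \<open>f\<close> at \<zeta>.\<close>

lemma gamma_Suc: "\<gamma> (Suc j) = \<zeta> * (\<gamma> j + of_int (a (Suc j)))"
proof -
  have "\<gamma> (Suc j) = (\<Sum>k=1..j. of_int (a k) * \<zeta> ^ (Suc j + 1 - k)) + of_int (a (Suc j)) * \<zeta>"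
    by (simp add: \<gamma>_def)
  also have "(\<Sum>k=1..j. of_int (a k) * \<zeta> ^ (Suc j + 1 - k)) = \<zeta> * \<gamma> j"
    unfolding \<gamma>_def sum_distrib_left
    by (rule sum.cong) (auto simp: Suc_diff_le mult_ac)
  finally show ?thesis by (simp add: algebra_simps)
qed

lemma gamma_n: "\<gamma> n = - of_int (a (n + 1))"
proof -
  have "0 = \<gamma> n + of_int (a (n + 1))"
    using root unfolding poly_f by (simp add: \<gamma>_def)
  then show ?thesis by (simp add: eq_neg_iff_add_eq_0)
qed

text \<open>If \<open>i + j < n\<close>, all powers in \<open>\<gamma> j * \<zeta> ^ i\<close> are
  below \<open>n\<close>. Otherwise the equation of \<zeta>, multiplied by
  \<open>\<zeta> ^ (i + j - n)\<close>, trades these terms for the remaining ones, whose exponents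
  are at most \<open>i\<close>.\<close>

lemma gamma_in_O:
  assumes "j \<le> n"
  shows "\<gamma> j \<in> \<O>"
proof -
  define S where "S = (\<lambda>i. \<zeta> ^ i) ` {..<n}"
  have fin: "finite S" unfolding S_def by simp
  have mem: "\<zeta> ^ i \<in> int_span S" if "i < n" for i
    using that by (intro int_span_base[OF fin]) (auto simp: S_def)
  have "\<gamma> j * \<zeta> ^ i \<in> int_span S" if i: "i < n" for i
  proof -
    have eq: "\<gamma> j * \<zeta> ^ i = (\<Sum>k=1..j. of_int (a k) * \<zeta> ^ (i + j + 1 - k))"
      unfolding \<gamma>_def sum_distrib_right
      by (rule sum.cong) (auto simp: mult.assoc simp flip: power_add intro!: arg_cong[of _ _ "\<lambda>e. \<zeta> ^ e"])
    show ?thesis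
    proof (cases "i + j < n")
      case True
      then show ?thesis
        unfolding eq by (intro int_span_sum int_span_of_int_mult mem) auto
    next
      case False
      have "0 = \<zeta> ^ (i + j - n) * (\<Sum>k=1..n+1. of_int (a k) * \<zeta> ^ (n + 1 - k))"
        using root unfolding poly_f by (simp del: sum.cl_ivl_Suc)
      also have "\<dots> = (\<Sum>k=1..n+1. of_int (a k) * \<zeta> ^ (i + j + 1 - k))"
        unfolding sum_distrib_left
      proof (rule sum.cong)
        fix k assume "k \<in> {1..n+1}"
        then have "i + j - n + (n + 1 - k) = i + j + 1 - k" using False by auto
        then show "\<zeta> ^ (i + j - n) * (of_int (a k) * \<zeta> ^ (n + 1 - k)) =
            of_int (a k) * \<zeta> ^ (i + j + 1 - k)"
          by (metis mult.left_commute power_add)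
      qed simp
      also have "{1..n+1} = {1..j} \<union> {j+1..n+1}"
        using assms by auto
      also have "(\<Sum>k\<in>\<dots>. of_int (a k) * \<zeta> ^ (i + j + 1 - k)) =
          \<gamma> j * \<zeta> ^ i + (\<Sum>k=j+1..n+1. of_int (a k) * \<zeta> ^ (i + j + 1 - k))"
        unfolding eq by (rule sum.union_disjoint) auto
      finally have "\<gamma> j * \<zeta> ^ i = - (\<Sum>k=j+1..n+1. of_int (a k) * \<zeta> ^ (i + j + 1 - k))"
        by (simp only: eq_neg_iff_add_eq_0)
      also have "\<dots> \<in> int_span S"
        using i by (intro int_span_uminus int_span_sum int_span_of_int_mult mem) auto
      finally show ?thesis .
    qed
  qed
  then have "algebraic_int (\<gamma> j)"
    using n_pos by (intro algebraic_int_if_stabilizes_int_span[OF fin, of 1])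
      (auto simp: S_def intro!: image_eqI[of _ _ 0])
  moreover have "\<gamma> j \<in> E"
    unfolding \<gamma>_def by (intro E_sum E_mult E_of_int E_power zeta_in_E)
  ultimately show ?thesis
    by (simp add: ring_of_integers_def)
qed

section \<open>The elements \<open>omega\<close> as integers of the field\<close>

lemma omega_simps:
  "omega a0 a \<zeta> 0 = 1" "omega a0 a \<zeta> (Suc 0) = of_int (a 1) / of_int a0 * \<zeta>"
  "j \<ge> 2 \<Longrightarrow> omega a0 a \<zeta> j = \<gamma> j"
  by (auto simp: omega_def \<gamma>_def)

text \<open>Stability of the span rests on \<open>?w 1 * ?w 1 = e * \<gamma> 2 - c * ?w 1\<close>,
  where both divisibilities enter, and on
  \<open>?w 1 * ?w j = a0 * e * \<gamma> (j + 1) - a (j + 1) * ?w 1\<close> for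
  \<open>j \<ge> 2\<close>.\<close>

lemma omega_1_in_O:
  assumes "n \<ge> 2" "a0 \<noteq> 0" "a0\<^sup>2 dvd a 1" "a0 dvd a 2"
  shows "omega a0 a \<zeta> 1 \<in> \<O>"
proof -
  obtain e c where e: "a 1 = a0\<^sup>2 * e" and c: "a 2 = a0 * c"
    using assms by (auto elim!: dvdE)
  let ?w = "omega a0 a \<zeta>"
  have w1: "?w 1 = of_int (a0 * e) * \<zeta>"
    using assms(2) by (simp add: omega_def e[simplified] power2_eq_square)
  define S where "S = ?w ` {..<n}"
  have fin: "finite S" unfolding S_def by simp
  have mem: "?w j \<in> int_span S" if "j < n" for j
    using that by (intro int_span_base[OF fin]) (auto simp: S_def)
  \<comment> \<open>The index \<open>Suc j = n\<close> is outside the list, but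
    \<open>\<gamma> n\<close> is an integer multiple of \<open>?w 0 = 1\<close>.\<close>
  have gamma: "\<gamma> (Suc j) \<in> int_span S" if "1 \<le> j" "j < n" for j
  proof (cases "Suc j < n")
    case True
    then show ?thesis using mem[of "Suc j"] that by (simp add: omega_simps)
  next
    case False
    then have "Suc j = n" using that by simp
    then have "\<gamma> (Suc j) = of_int (- a (n + 1)) * ?w 0"
      using gamma_n by (simp add: omega_simps)
    then show ?thesis
      using int_span_of_int_mult[OF mem[OF n_pos]] by metis
  qed
  have "?w 1 * ?w j \<in> int_span S" if j: "j < n" for j
  proof -
    consider "j = 0" | "j = 1" | "j \<ge> 2" by linarith
    then show ?thesis
    proof cases
      case 1
      then show ?thesis using mem[of 1] assms(1) by (simp add: omega_simps)
    next
      case 2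
      have "\<gamma> (Suc 1) = \<zeta> * (\<gamma> 1 + of_int (a 2))"
        unfolding gamma_Suc by (simp add: numeral_2_eq_2)
      then have "?w 1 * ?w 1 = of_int e * \<gamma> (Suc 1) + of_int (- c) * ?w 1"
        unfolding w1 gamma_1 e c by (simp add: algebra_simps power2_eq_square)
      also have "\<dots> \<in> int_span S"
        using assms(1) by (intro int_span_add int_span_of_int_mult gamma mem) auto
      finally show ?thesis using 2 by simp
    next
      case 3
      then have "?w 1 * ?w j = of_int (a0 * e) * \<gamma> (Suc j) + of_int (- a (Suc j)) * ?w 1"
        unfolding w1 gamma_Suc by (simp add: omega_simps algebra_simps)
      also have "\<dots> \<in> int_span S"
        using assms(1) j 3 by (intro int_span_add int_span_of_int_mult gamma mem) auto
      finally show ?thesis .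
    qed
  qed
  then have "algebraic_int (?w 1)"
    using n_pos by (intro algebraic_int_if_stabilizes_int_span[OF fin, of 1])
      (auto simp: S_def omega_simps intro!: image_eqI[of _ _ 0])
  moreover have "?w 1 \<in> E"
    unfolding w1 by (intro E_mult E_of_int zeta_in_E)
  ultimately show ?thesis
    by (simp add: ring_of_integers_def)
qed

lemma omega_in_O:
  assumes "a0 \<noteq> 0" "a0\<^sup>2 dvd a 1" "a0 dvd a 2" "j < n"
  shows "omega a0 a \<zeta> j \<in> \<O>"
proof -
  consider "j = 0" | "j = 1" | "j \<ge> 2" by linarith
  then show ?thesis
  proof cases
    case 1
    then show ?thesis using O_of_int[of 1] by (simp add: omega_simps)
  next
    case 2
    then show ?thesis using omega_1_in_O assms by simp
  next
    case 3
    then show ?thesis using gamma_in_O[of j] assms by (simp add: omega_simps)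
  qed
qed

section \<open>The discriminant of the list of the \<open>omega\<close>\<close>

lemma basis_disc_omega:
  "basis_disc E (map (omega a0 a \<zeta>) [0..<n]) =
    (\<Prod>i<n. if i = 0 then 1 else if i = 1 then of_int (a 1) / of_int a0 else of_int (a 1))\<^sup>2 *
    basis_disc E powers"
proof -
  \<comment> \<open>\<open>c i j\<close> is the coefficient of \<open>\<zeta> ^ j\<close> in
    \<open>omega a0 a \<zeta> i\<close>; for \<open>i \<ge> 2\<close> the exponent
    \<open>j = i + 1 - k\<close> belongs to \<open>k = i + 1 - j\<close>. Since
    \<open>j \<le> i\<close> throughout, the matrix is lower triangular.\<close>
  define c :: "nat \<Rightarrow> nat \<Rightarrow> rat" where
    "c i j = (if i = 0 then (if j = 0 then 1 else 0)
      else if i = 1 then (if j = 1 then of_int (a 1) / of_int a0 else 0)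
      else if j \<in> {1..i} then of_int (a (i + 1 - j)) else 0)" for i j
  let ?C = "mat n n (\<lambda>(i, j). c i j)"
  have omega: "omega a0 a \<zeta> i = (\<Sum>j<n. of_rat (c i j) * \<zeta> ^ j)" if i: "i < n" for i
  proof -
    consider "i = 0" | "i = 1" | "i \<ge> 2" by linarith
    then show ?thesis
    proof cases
      case 1
      then have "(\<Sum>j<n. of_rat (c i j) * \<zeta> ^ j) = (\<Sum>j<n. if j = 0 then 1 else 0)"
        by (intro sum.cong) (auto simp: c_def)
      then show ?thesis using 1 i by (simp add: omega_simps)
    next
      case 2
      then have "(\<Sum>j<n. of_rat (c i j) * \<zeta> ^ j) =
          (\<Sum>j<n. if j = 1 then of_int (a 1) / of_int a0 * \<zeta> else 0)"
        by (intro sum.cong) (auto simp: c_def of_rat_divide)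
      then show ?thesis using 2 i by (simp add: omega_simps)
    next
      case 3
      have "(\<Sum>j<n. of_rat (c i j) * \<zeta> ^ j) = (\<Sum>j=1..i. of_int (a (i + 1 - j)) * \<zeta> ^ j)"
        using 3 i by (intro sum.mono_neutral_cong_right) (auto simp: c_def)
      also have "\<dots> = \<gamma> i"
        unfolding \<gamma>_def
        by (rule sum.reindex_bij_witness[of _ "\<lambda>k. i + 1 - k" "\<lambda>k. i + 1 - k"]) auto
      finally show ?thesis using 3 by (simp add: omega_simps)
    qed
  qed
  have "basis_disc E (map (omega a0 a \<zeta>) [0..<n]) = (of_rat (det ?C))\<^sup>2 * basis_disc E powers"
    by (rule basis_disc_change[of _ n]) (auto simp: omega intro!: E_power zeta_in_E)
  also have "det ?C = (\<Prod>i<n. c i i)"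
    by (subst det_lower_triangular[of n]) (auto simp: c_def prod_list_diag_prod atLeast0LessThan)
  also have "of_rat \<dots> = (\<Prod>i<n. if i = 0 then 1
      else if i = 1 then of_int (a 1) / of_int a0 else of_int (a 1) :: complex)"
    unfolding of_rat_prod by (intro prod.cong) (auto simp: c_def of_rat_divide)
  finally show ?thesis .
qed

lemma basis_disc_omega_nonzero:
  assumes "a0 \<noteq> 0"
  shows "basis_disc E (map (omega a0 a \<zeta>) [0..<n]) \<noteq> 0"
  unfolding basis_disc_omega using basis_disc_powers_nonzero a1_nonzero assms by auto

text \<open>For \<open>n \<ge> 2\<close> the diagonal product is \<open>a 1 ^ (n - 1) / a0\<close>,
  whose square cancels \<open>a0\<^sup>2\<close> in the hypothesis. For \<open>n = 1\<close> the
  factor with \<open>1 / a0\<close> is absent; there the form has discriminant 1, and the hypothesis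
  forces \<open>field_disc E = 1\<close>.\<close>

lemma basis_disc_omega_eq_field_disc:
  assumes "a0 \<noteq> 0" and disc: "binary_form_disc n a = of_int (field_disc E * a0\<^sup>2)"
  shows "basis_disc E (map (omega a0 a \<zeta>) [0..<n]) = of_int (field_disc E)"
proof (cases "n = 1")
  case True
  obtain d where "bij_betw d {..<n} R"
    by (rule enumerate_R)
  from basis_disc_powers[OF this] have powers: "basis_disc E powers = 1"
    using True by simp
  then have "(of_int (field_disc E * a0\<^sup>2) :: complex) = of_int 1"
    using disc True unfolding binary_form_disc_eq by simp
  then have "field_disc E * a0\<^sup>2 = 1"
    using of_int_eq_iff by blast
  then have "field_disc E = 1"
    by (smt (verit) zmult_eq_1_iff zero_le_power2)
  then show ?thesis
    unfolding basis_disc_omega using powers True by simp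
next
  case False
  then have "n = Suc (Suc (n - 2))"
    using n_pos by simp
  then obtain m where m: "n = Suc (Suc m)" ..
  have "(\<Prod>i<n. if i = 0 then 1 else if i = 1 then of_int (a 1) / of_int a0 else of_int (a 1)) =
      of_int (a 1) ^ (n - 1) / (of_int a0 :: complex)"
    unfolding m by (simp add: prod.lessThan_Suc_shift del: prod.lessThan_Suc)
  then have "basis_disc E (map (omega a0 a \<zeta>) [0..<n]) =
      of_int (a 1) ^ (2 * (n - 1)) * basis_disc E powers / (of_int a0)\<^sup>2"
    unfolding basis_disc_omega by (simp add: power_divide power_mult[symmetric] mult.commute)
  also have "\<dots> = of_int (field_disc E)"
    using disc assms(1) unfolding binary_form_disc_eq by simp
  finally show ?thesis .
qed

end

theorem theorem4p1:
  fixes n :: nat and a :: "nat \<Rightarrow> int" and f :: "int poly"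
    and \<zeta> :: complex and a0 :: int
  assumes "f = (\<Sum>k=1..n+1. monom (a k) (n + 1 - k))"
    and "degree f = n"
    and "irreducible f"
    and "poly (map_poly of_int f) \<zeta> = 0"
    and "a0 \<noteq> 0"
    and "a0\<^sup>2 dvd a 1"
    and "a0 dvd a 2"
    and "binary_form_disc n a = of_int (field_disc (rat_adjoin \<zeta>) * a0\<^sup>2)"
  shows "is_integral_basis (rat_adjoin \<zeta>) (map (omega a0 a \<zeta>) [0..<n])"
proof -
  interpret root: int_poly_root f \<zeta>
    using assms by unfold_locales
  have n: "root.n = n"
    using assms(2) by (simp add: root.n_def)
  interpret form: int_form_root f \<zeta> a
    by unfold_locales (unfold n, rule assms(1))
  show ?thesis
  proof (rule root.integral_basis_if_disc_eq_field_disc)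
    show "length (map (omega a0 a \<zeta>) [0..<n]) = root.n"
      by (simp add: n)
    show "set (map (omega a0 a \<zeta>) [0..<n]) \<subseteq> ring_of_integers (rat_adjoin \<zeta>)"
      using form.omega_in_O[OF assms(5-7)] by (auto simp: n)
    show "basis_disc (rat_adjoin \<zeta>) (map (omega a0 a \<zeta>) [0..<n]) \<noteq> 0"
      using form.basis_disc_omega_nonzero[OF assms(5)] by (simp add: n)
    show "basis_disc (rat_adjoin \<zeta>) (map (omega a0 a \<zeta>) [0..<n]) =
        of_int (field_disc (rat_adjoin \<zeta>))"
      using form.basis_disc_omega_eq_field_disc[OF assms(5)] assms(8) by (simp only: n)
  qed
qed

end
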